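(* Let $1\le q<p<\infty$ and let $\Omega\subset\mathbb{R}^N$ be an open bounded convex set. Then \[ \lambda_{p,q}(\Omega)\,|\Omega|^{\frac{p-q}{q}}\ge\Big(\frac{\pi_{p,q}}{2}\Big)^p\frac{1}{r_\Omega^p}. \] Moreover, the estimate is sharp: $\inf\big\{\lambda_{p,q}(\Omega)|\Omega|^{\frac{p-q}{q}}r_\Omega^p\big\}=(\pi_{p,q}/2)^p$, the infimum being over all open bounded convex $\Omega\subset\mathbb{R}^N$.
   Context: $\lambda_{p,q}(\Omega)=\inf_{\psi\in C^\infty_0(\Omega)}\{\int_\Omega|\nabla\psi|^p\,dx:\int_\Omega|\psi|^q\,dx=1\}$; $|\Omega|$ is the Lebesgue measure; $r_\Omega=\sup\{r>0:\exists x_0\in\Omega,\ B_r(x_0)\subset\Omega\}$ is the inradius; $\pi_{p,q}=\inf\{\|u'\|_{L^p(0,1)}:u\in C^\infty_0((0,1)),\ \|u\|_{L^q(0,1)}=1\}$. *)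

theory Defs
  imports "HOL-Analysis.Analysis"
begin

coinductive smooth :: "('a::euclidean_space \<Rightarrow> real) \<Rightarrow> bool" where
  "(\<forall>x. g differentiable (at x)) \<Longrightarrow> (\<forall>v. smooth (\<lambda>x. frechet_derivative g (at x) v))
     \<Longrightarrow> smooth g"

definition Cc_inf :: "'a::euclidean_space set \<Rightarrow> ('a \<Rightarrow> real) set" where
  "Cc_inf \<Omega> = {\<psi>. smooth \<psi> \<and> compact (closure {x. \<psi> x \<noteq> 0})
                     \<and> closure {x. \<psi> x \<noteq> 0} \<subseteq> \<Omega>}"

definition grad :: "('a::euclidean_space \<Rightarrow> real) \<Rightarrow> 'a \<Rightarrow> 'a" where
  "grad f x = (\<Sum>b\<in>Basis. frechet_derivative f (at x) b *\<^sub>R b)"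

definition lambda_pq :: "real \<Rightarrow> real \<Rightarrow> 'a::euclidean_space set \<Rightarrow> real" where
  "lambda_pq p q \<Omega> = Inf {(LINT x:\<Omega>|lborel. norm (grad \<psi> x) powr p) | \<psi>.
        \<psi> \<in> Cc_inf \<Omega> \<and> (LINT x:\<Omega>|lborel. \<bar>\<psi> x\<bar> powr q) = 1}"

definition inradius :: "'a::euclidean_space set \<Rightarrow> real" where
  "inradius \<Omega> = Sup {r. r > 0 \<and> (\<exists>x0\<in>\<Omega>. ball x0 r \<subseteq> \<Omega>)}"

definition pi_pq :: "real \<Rightarrow> real \<Rightarrow> real" where
  "pi_pq p q = Inf {(LINT x:{0<..<1}|lborel. \<bar>deriv u x\<bar> powr p) powr (1/p) | u.
        u \<in> Cc_inf {0<..<(1::real)} \<and> (LINT x:{0<..<1}|lborel. \<bar>u x\<bar> powr q) powr (1/q) = 1}"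

end

theory Submission
  imports Defs "HOL-Computational_Algebra.Polynomial"
begin

text \<open>
  Fix a test function \<open>\<psi>\<close>. Its support lies in a bounded intersection of half-spaces contained in
  \<open>\<Omega>\<close>, which is cut into cells according to the nearest facet. Inside a cell, the lines orthogonal
  to the facet meet the cell in segments that start on the facet and have length at most the inradius.
  On such a segment \<open>\<psi>\<close> vanishes at one end, so even reflection at the other end gives the
  one-dimensional inequality with constant \<open>\<pi>\<^sub>p\<^sub>q / 2\<close>. Replacing the convex function \<open>y powr (p/q)\<close>
  by its tangent at \<open>1 / |\<Omega>|\<close> makes the inequality additive in the segments, so it can be integrated
  over each cell and summed over the cells. Sharpness is seen on thin slabs, with test functions
  \<open>u (x\<^sub>1 / \<epsilon>) * \<eta> x\<close>.
\<close>

subsection \<open>Calculus of smooth functions\<close>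

text \<open>The smooth test functions force the rounding of the fold: an even reflection is in
  general only Lipschitz at the fold, whereas \<open>pi_pq\<close> admits smooth competitors only.
  So the fold is rounded at scale \<open>e\<close>, and \<open>e\<close> tends to 0. Finitely many
  half-spaces avoid any discussion of the regularity of the distance to the boundary of \<Omega>:
  the distance becomes a minimum of finitely many affine functions, and \<psi> itself is still a
  test function on the smaller set. The inradius enters because the distance to the nearest facet is
  the radius of a ball contained in the polytope. The tangent at \<open>1 / |\<Omega>|\<close> costs
  nothing, as in Jensen's inequality, because the normalisation makes this number the mean of
  \<open>\<bar>\<psi> x\<bar> powr q\<close> over \<Omega>. Sharpness needs two small parameters in
  a fixed order: for a fixed transition layer of the cutoff \<eta>, its gradient is negligible
  against \<open>1 / \<epsilon>\<close> as the slab gets thin; only then may the layer shrink, since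
  its gradient bound depends on its width.\<close>

lemma smooth_differentiable: "smooth f \<Longrightarrow> f differentiable (at x)"
  by (auto elim: smooth.cases)

lemma smooth_frechet_derivative: "smooth f \<Longrightarrow> smooth (\<lambda>x. frechet_derivative f (at x) v)"
  by (auto elim: smooth.cases)

lemma smooth_has_derivative:
  "smooth f \<Longrightarrow> (f has_derivative frechet_derivative f (at x)) (at x)"
  using smooth_differentiable frechet_derivative_works by blast

lemma smooth_continuous_on: "smooth f \<Longrightarrow> continuous_on S f"
  by (meson smooth_differentiable differentiable_imp_continuous_within continuous_at_imp_continuous_on)

text \<open>A direct coinduction for products fails, because the derivative of a product is a sum of
  products. This class is closed under directional derivatives as well as under the operations, so
  it serves as the invariant of one coinduction for all of them.\<close>

inductive smooth_closure :: "('a::euclidean_space \<Rightarrow> real) \<Rightarrow> bool" where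
  base: "smooth f \<Longrightarrow> smooth_closure f"
| const: "smooth_closure (\<lambda>x. c)"
| inner: "smooth_closure (\<lambda>x. x \<bullet> b)"
| add: "smooth_closure f \<Longrightarrow> smooth_closure g \<Longrightarrow> smooth_closure (\<lambda>x. f x + g x)"
| mult: "smooth_closure f \<Longrightarrow> smooth_closure g \<Longrightarrow> smooth_closure (\<lambda>x. f x * g x)"
| powr: "smooth_closure f \<Longrightarrow> (\<And>x. f x > 0) \<Longrightarrow> smooth_closure (\<lambda>x. f x powr a)"
| comp: "smooth (h :: real \<Rightarrow> real) \<Longrightarrow> smooth_closure g \<Longrightarrow> smooth_closure (\<lambda>x. h (g x))"

lemma smooth_closure_has_derivative:
  assumes "smooth_closure f"
  shows "\<exists>f'. (\<forall>x. (f has_derivative f' x) (at x)) \<and> (\<forall>v. smooth_closure (\<lambda>x. f' x v))"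
  using assms
proof induction
  case (base f)
  then show ?case
    by (intro exI[of _ "\<lambda>x. frechet_derivative f (at x)"])
      (simp add: smooth_has_derivative smooth_frechet_derivative smooth_closure.base)
next
  case (const c)
  show ?case
    by (rule exI[of _ "\<lambda>x v. 0"]) (auto intro: smooth_closure.const)
next
  case (inner b)
  show ?case
    by (rule exI[of _ "\<lambda>x v. v \<bullet> b"])
      (auto intro!: derivative_eq_intros smooth_closure.const)
next
  case (add f g)
  then obtain f' g' where
    "\<forall>x. (f has_derivative f' x) (at x)" "\<forall>v. smooth_closure (\<lambda>x. f' x v)"
    "\<forall>x. (g has_derivative g' x) (at x)" "\<forall>v. smooth_closure (\<lambda>x. g' x v)"
    by blast
  then show ?case
    by (intro exI[of _ "\<lambda>x v. f' x v + g' x v"])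
      (auto intro!: has_derivative_add smooth_closure.add)
next
  case (mult f g)
  then obtain f' g' where
    "\<forall>x. (f has_derivative f' x) (at x)" "\<forall>v. smooth_closure (\<lambda>x. f' x v)"
    "\<forall>x. (g has_derivative g' x) (at x)" "\<forall>v. smooth_closure (\<lambda>x. g' x v)"
    by blast
  with mult.hyps show ?case
    by (intro exI[of _ "\<lambda>x v. f x * g' x v + f' x v * g x"])
      (auto intro!: has_derivative_mult smooth_closure.add smooth_closure.mult)
next
  case (powr f a)
  then obtain f' where f':
    "\<forall>x. (f has_derivative f' x) (at x)" "\<forall>v. smooth_closure (\<lambda>x. f' x v)"
    by blast
  have "((\<lambda>y. f y powr a) has_derivative (\<lambda>v. a * f x powr (a - 1) * f' x v)) (at x)" for x
  proof -
    have "((\<lambda>y. y powr a) has_real_derivative a * f x powr (a - 1)) (at (f x))"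
      using powr.hyps by (intro has_real_derivative_powr) auto
    with f'(1) show ?thesis
      using has_derivative_compose[of f "f' x" x UNIV "\<lambda>y. y powr a" "(*) (a * f x powr (a - 1))"]
      by (simp add: has_field_derivative_def)
  qed
  moreover have "smooth_closure (\<lambda>x. a * f x powr (a - 1) * f' x v)" for v
    using f' powr.hyps by (intro smooth_closure.mult smooth_closure.const smooth_closure.powr) auto
  ultimately show ?case by (intro exI[of _ "\<lambda>x v. a * f x powr (a - 1) * f' x v"]) auto
next
  case (comp h g)
  then obtain g' where g':
    "\<forall>x. (g has_derivative g' x) (at x)" "\<forall>v. smooth_closure (\<lambda>x. g' x v)"
    by blast
  \<comment> \<open>The derivative of \<open>h\<close> at a real point is multiplication by the
    number \<open>h' y\<close>. In this form the chain rule produces a product of two members of the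
    class, with \<open>h'\<close> smooth again.\<close>
  define h' where "h' = (\<lambda>y. frechet_derivative h (at y) 1)"
  have h': "frechet_derivative h (at y) v = h' y * v" for y v
  proof -
    have "linear (frechet_derivative h (at y))"
      using smooth_has_derivative[OF comp.hyps(1)] has_derivative_linear by blast
    from linear_scale[OF this, of v 1] show ?thesis by (simp add: h'_def mult.commute)
  qed
  have "((\<lambda>y. h (g y)) has_derivative (\<lambda>v. h' (g x) * g' x v)) (at x)" for x
    using has_derivative_compose[OF g'(1)[rule_format] smooth_has_derivative[OF comp.hyps(1)]]
    by (simp add: h')
  moreover have "smooth h'"
    unfolding h'_def by (rule smooth_frechet_derivative) fact
  then have "smooth_closure (\<lambda>x. h' (g x) * g' x v)" for v
    using smooth_closure.mult[OF smooth_closure.comp[of h' g]] g' comp.hyps by simp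
  ultimately show ?case by (intro exI[of _ "\<lambda>x v. h' (g x) * g' x v"]) auto
qed

lemma smooth_closure_imp_smooth: "smooth_closure f \<Longrightarrow> smooth f"
proof (coinduction arbitrary: f rule: smooth.coinduct)
  case (smooth f)
  then obtain f' where f': "\<And>x. (f has_derivative f' x) (at x)" "\<And>v. smooth_closure (\<lambda>x. f' x v)"
    using smooth_closure_has_derivative by blast
  then have "frechet_derivative f (at x) = f' x" for x
    by (metis frechet_derivative_at)
  with f' show ?case by (auto simp: differentiable_def)
qed

lemma smooth_const: "smooth (\<lambda>x. c)"
  by (rule smooth_closure_imp_smooth[OF smooth_closure.const])

lemma smooth_inner: "smooth (\<lambda>x. x \<bullet> b)"
  by (rule smooth_closure_imp_smooth[OF smooth_closure.inner])

lemma smooth_add: "smooth f \<Longrightarrow> smooth g \<Longrightarrow> smooth (\<lambda>x. f x + g x)"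
  by (rule smooth_closure_imp_smooth[OF smooth_closure.add[OF smooth_closure.base smooth_closure.base]])

lemma smooth_mult: "smooth f \<Longrightarrow> smooth g \<Longrightarrow> smooth (\<lambda>x. f x * g x)"
  by (rule smooth_closure_imp_smooth[OF smooth_closure.mult[OF smooth_closure.base smooth_closure.base]])

lemma smooth_powr: "smooth f \<Longrightarrow> (\<And>x. f x > 0) \<Longrightarrow> smooth (\<lambda>x. f x powr a)"
  by (rule smooth_closure_imp_smooth[OF smooth_closure.powr[OF smooth_closure.base]])

lemma smooth_compose:
  fixes h :: "real \<Rightarrow> real"
  shows "smooth h \<Longrightarrow> smooth f \<Longrightarrow> smooth (\<lambda>x. h (f x))"
  by (rule smooth_closure_imp_smooth[OF smooth_closure.comp[OF _ smooth_closure.base]])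

lemma smooth_ident: "smooth (\<lambda>x::real. x)"
  using smooth_inner[of "1::real"] by simp

lemma smooth_diff: "smooth f \<Longrightarrow> smooth g \<Longrightarrow> smooth (\<lambda>x. f x - g x)"
  using smooth_add[of f "\<lambda>x. - 1 * g x"] smooth_mult[OF smooth_const, of g "- 1"] by simp

lemma smooth_divide:
  assumes "smooth f" "smooth g" "\<And>x. g x > 0"
  shows "smooth (\<lambda>x. f x / g x)"
proof -
  have "smooth (\<lambda>x. f x * g x powr (- 1))"
    using assms by (intro smooth_mult smooth_powr)
  then show ?thesis
    using assms(3) by (simp add: powr_minus divide_inverse less_imp_le)
qed

lemma smooth_sqrt:
  assumes "smooth f" "\<And>x. f x > 0"
  shows "smooth (\<lambda>x. sqrt (f x))"
  using smooth_powr[OF assms, of "1/2"] assms(2) by (simp add: powr_half_sqrt less_imp_le)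

lemma smooth_sum: "finite I \<Longrightarrow> (\<And>i. i \<in> I \<Longrightarrow> smooth (f i)) \<Longrightarrow> smooth (\<lambda>x. \<Sum>i\<in>I. f i x)"
  by (induction rule: finite_induct) (auto intro: smooth_const smooth_add)

lemma smooth_prod: "finite I \<Longrightarrow> (\<And>i. i \<in> I \<Longrightarrow> smooth (f i)) \<Longrightarrow> smooth (\<lambda>x. \<Prod>i\<in>I. f i x)"
  by (induction rule: finite_induct) (auto intro: smooth_const smooth_mult)

lemma has_derivative_along_line:
  assumes "smooth f"
  shows "((\<lambda>t. f (a + t *\<^sub>R n)) has_derivative (\<lambda>v. frechet_derivative f (at (a + t *\<^sub>R n)) (v *\<^sub>R n))) (at t)"
  by (rule has_derivative_compose[OF _ smooth_has_derivative[OF assms]])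
    (auto intro!: derivative_eq_intros)

text \<open>Here the inner function changes the domain, which the closure class does not cover: its
  compositions act from outside. The invariant is the set of restrictions of all smooth functions to
  the fixed line; differentiation in direction \<open>v\<close> restricts the derivative in
  direction \<open>v *\<^sub>R n\<close>.\<close>

lemma smooth_along_line:
  fixes f :: "'a::euclidean_space \<Rightarrow> real"
  assumes "smooth f"
  shows "smooth (\<lambda>t::real. f (a + t *\<^sub>R n))"
proof -
  have "\<exists>f. smooth f \<and> (\<lambda>t::real. f (a + t *\<^sub>R n)) = g \<Longrightarrow> smooth g" for g
  proof (coinduction arbitrary: g rule: smooth.coinduct)
    case (smooth g)
    then obtain f where f: "smooth f" "g = (\<lambda>t::real. f (a + t *\<^sub>R n))" by auto
    have d: "(g has_derivative (\<lambda>v. frechet_derivative f (at (a + t *\<^sub>R n)) (v *\<^sub>R n))) (at t)" for t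
      unfolding f(2) using has_derivative_along_line[OF f(1)] .
    then have "frechet_derivative g (at t) = (\<lambda>v. frechet_derivative f (at (a + t *\<^sub>R n)) (v *\<^sub>R n))" for t
      by (metis frechet_derivative_at)
    with d smooth_frechet_derivative[OF f(1)] show ?case
      by (auto simp: differentiable_def)
  qed
  with assms show ?thesis by blast
qed

lemma smooth_has_real_derivative:
  fixes f :: "real \<Rightarrow> real"
  shows "smooth f \<Longrightarrow> (f has_real_derivative deriv f x) (at x)"
  using smooth_differentiable[of f x]
  by (simp add: DERIV_deriv_iff_real_differentiable)

lemma deriv_eq_frechet_derivative:
  fixes f :: "real \<Rightarrow> real"
  assumes "smooth f"
  shows "deriv f x = frechet_derivative f (at x) 1"
  using smooth_has_real_derivative[OF assms, of x]
  by (metis frechet_derivative_at has_field_derivative_def mult.right_neutral)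

lemma smooth_deriv:
  fixes f :: "real \<Rightarrow> real"
  assumes "smooth f"
  shows "smooth (deriv f)"
proof -
  have "deriv f = (\<lambda>x. frechet_derivative f (at x) 1)"
    using deriv_eq_frechet_derivative[OF assms] by (rule ext)
  with smooth_frechet_derivative[OF assms] show ?thesis by simp
qed

section \<open>A smooth function that is positive exactly on the positive half-line\<close>

definition flat :: "real poly \<Rightarrow> real \<Rightarrow> real" where
  "flat P x = (if x > 0 then poly P (1 / x) * exp (- 1 / x) else 0)"

lemma flat_tendsto_0: "(flat P \<longlongrightarrow> 0) (at 0)"
proof -
  have mon: "((\<lambda>z::real. coeff P i * z ^ i * exp (- z)) \<longlongrightarrow> 0) at_top" for i
    using tendsto_mult[OF tendsto_const[of "coeff P i"] tendsto_power_div_exp_0[of i]]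
    by (simp add: exp_minus divide_inverse mult.assoc)
  have "((\<lambda>z::real. \<Sum>i\<le>degree P. coeff P i * z ^ i * exp (- z)) \<longlongrightarrow> 0) at_top"
    using tendsto_sum[of "{..degree P}", OF mon] by simp
  then have "((\<lambda>z::real. poly P z * exp (- z)) \<longlongrightarrow> 0) at_top"
    by (simp add: poly_altdef sum_distrib_right)
  from filterlim_compose[OF this filterlim_inverse_at_top_right]
  have "((\<lambda>x::real. poly P (1 / x) * exp (- 1 / x)) \<longlongrightarrow> 0) (at_right 0)"
    by (simp add: field_simps)
  then have "(flat P \<longlongrightarrow> 0) (at_right 0)"
    by (rule Lim_transform_eventually)
      (auto simp: flat_def eventually_at_filter)
  moreover have "(flat P \<longlongrightarrow> 0) (at_left 0)"
    by (rule Lim_transform_eventually[OF tendsto_const])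
      (auto simp: flat_def eventually_at_filter)
  ultimately show ?thesis by (simp add: filterlim_at_split)
qed

text \<open>An arbitrary polynomial in \<open>1 / x\<close> is carried along to make the family
  closed under differentiation: the chain rule contributes the factor
  \<open>(1 / x)\<^sup>2\<close>, that is, \<open>[:0, 0, 1:]\<close> evaluated at
  \<open>1 / x\<close>. At the origin the difference quotient is again of this kind, with polynomial
  \<open>P * [:0, 1:]\<close>, and tends to 0.\<close>

lemma flat_has_derivative:
  "(flat P has_real_derivative flat ((P - pderiv P) * [:0, 0, 1:]) x) (at x)"
proof -
  consider "x > 0" | "x = 0" | "x < 0" by linarith
  then show ?thesis
  proof cases
    case 1
    have "((\<lambda>x. poly P (1 / x) * exp (- 1 / x)) has_real_derivative
        flat ((P - pderiv P) * [:0, 0, 1:]) x) (at x)"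
      using 1 by (auto intro!: derivative_eq_intros DERIV_chain'[OF _ poly_DERIV]
          simp: flat_def field_simps power2_eq_square)
    then show ?thesis
      by (rule DERIV_cong_ev[THEN iffD1, rotated 3])
        (use 1 eventually_nhds_in_open[of "{0<..}" x] in \<open>auto simp: flat_def elim!: eventually_mono\<close>)
  next
    case 2
    have "((\<lambda>h. (flat P (0 + h) - flat P 0) / h) \<longlongrightarrow> 0) (at 0)"
    proof (rule Lim_transform_eventually[OF flat_tendsto_0[of "P * [:0, 1:]"]])
      show "\<forall>\<^sub>F h in at 0. flat (P * [:0, 1:]) h = (flat P (0 + h) - flat P 0) / h"
        by (auto simp: flat_def eventually_at_filter)
    qed
    with 2 show ?thesis by (simp add: DERIV_def flat_def)
  next
    case 3
    have "((\<lambda>x. 0) has_real_derivative flat ((P - pderiv P) * [:0, 0, 1:]) x) (at x)"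
      using 3 by (simp add: flat_def)
    then show ?thesis
      by (rule DERIV_cong_ev[THEN iffD1, rotated 3])
        (use 3 eventually_nhds_in_open[of "{..<0}" x] in \<open>auto simp: flat_def elim!: eventually_mono\<close>)
  qed
qed

lemma smooth_flat: "smooth (flat P)"
proof (coinduction arbitrary: P rule: smooth.coinduct)
  case (smooth P)
  \<comment> \<open>The direction contributes only a scalar factor; \<open>smult\<close> absorbs it,
    so the directional derivative is again of the form \<open>flat Q\<close>, as the coinduction
    requires.\<close>
  have "frechet_derivative (flat P) (at x) v = flat (smult v ((P - pderiv P) * [:0, 0, 1:])) x" for x v
  proof -
    have "frechet_derivative (flat P) (at x) v = flat ((P - pderiv P) * [:0, 0, 1:]) x * v"
      using flat_has_derivative[of P x, unfolded has_field_derivative_def, THEN frechet_derivative_at]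
      by metis
    then show ?thesis by (simp add: flat_def)
  qed
  moreover have "flat P differentiable (at x)" for x
    using flat_has_derivative real_differentiable_def by blast
  ultimately show ?case by auto
qed

lemma ex_smooth_positive:
  "\<exists>h :: real \<Rightarrow> real. smooth h \<and> (\<forall>x>0. h x > 0) \<and> (\<forall>x\<le>0. h x = 0)"
  by (rule exI[of _ "flat 1"]) (auto simp: smooth_flat flat_def)

section \<open>Test functions and their integrals\<close>

lemma compact_support_integrable:
  fixes f :: "'a::euclidean_space \<Rightarrow> real"
  assumes "compact K" "continuous_on UNIV f" "\<And>x. x \<notin> K \<Longrightarrow> f x = 0"
  shows "integrable lborel f"
proof -
  have "(\<lambda>x. indicator K x *\<^sub>R f x) = f"
    using assms(3) by (auto simp: fun_eq_iff indicator_def)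
  with borel_integrable_compact[OF assms(1) continuous_on_subset[OF assms(2) subset_UNIV]]
  show ?thesis by simp
qed

lemma set_integral_eq_integral_support:
  fixes f :: "'a \<Rightarrow> real"
  assumes "\<And>x. x \<notin> A \<Longrightarrow> f x = 0"
  shows "(LINT x:A|M. f x) = (LINT x|M. f x)"
  unfolding set_lebesgue_integral_def
  by (rule Bochner_Integration.integral_cong) (use assms in \<open>auto simp: indicator_def\<close>)

lemma Cc_infD:
  assumes "\<psi> \<in> Cc_inf \<Omega>"
  shows "smooth \<psi>" "compact (closure {x. \<psi> x \<noteq> 0})" "closure {x. \<psi> x \<noteq> 0} \<subseteq> \<Omega>"
  using assms by (auto simp: Cc_inf_def)

lemma Cc_infI:
  assumes "smooth \<psi>" "compact K" "K \<subseteq> \<Omega>" "\<And>x. x \<notin> K \<Longrightarrow> \<psi> x = 0"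
  shows "\<psi> \<in> Cc_inf \<Omega>"
proof -
  have sub: "closure {x. \<psi> x \<noteq> 0} \<subseteq> K"
    using assms by (intro closure_minimal compact_imp_closed) auto
  then have "compact (closure {x. \<psi> x \<noteq> 0})"
    using assms(2) by (meson bounded_subset closed_closure compact_eq_bounded_closed)
  with assms sub show ?thesis by (auto simp: Cc_inf_def)
qed

lemma zero_outside_support: "x \<notin> closure {x. \<psi> x \<noteq> 0} \<Longrightarrow> \<psi> x = 0"
  using closure_subset[of "{x. \<psi> x \<noteq> 0}"] by blast

lemma frechet_derivative_outside_support:
  assumes "x \<notin> closure {x. \<psi> x \<noteq> 0}"
  shows "frechet_derivative \<psi> (at x) = (\<lambda>v. 0 :: real)"
proof -
  have "((\<lambda>x. 0) has_derivative (\<lambda>v. 0)) (at x)" by simp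
  then have "(\<psi> has_derivative (\<lambda>v. 0)) (at x)"
    by (rule has_derivative_transform_within_open[where s = "- closure {x. \<psi> x \<noteq> 0}"])
      (use assms zero_outside_support in \<open>auto simp: open_Compl\<close>)
  then show ?thesis by (metis frechet_derivative_at)
qed

lemma grad_outside_support: "x \<notin> closure {x. \<psi> x \<noteq> 0} \<Longrightarrow> grad \<psi> x = 0"
  by (simp add: grad_def frechet_derivative_outside_support)

lemma smooth_grad_continuous: "smooth \<psi> \<Longrightarrow> continuous_on S (grad \<psi>)"
  unfolding grad_def
  by (intro continuous_intros smooth_continuous_on[OF smooth_frechet_derivative])

lemma frechet_derivative_eq_inner_grad:
  assumes "smooth \<psi>"
  shows "frechet_derivative \<psi> (at x) v = grad \<psi> x \<bullet> v"
proof -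
  have lin: "linear (frechet_derivative \<psi> (at x))"
    using smooth_has_derivative[OF assms] has_derivative_linear by blast
  have "frechet_derivative \<psi> (at x) v = frechet_derivative \<psi> (at x) (\<Sum>b\<in>Basis. (b \<bullet> v) *\<^sub>R b)"
    by (simp add: euclidean_representation inner_commute[of _ v])
  also have "\<dots> = grad \<psi> x \<bullet> v"
    by (simp add: linear_sum[OF lin] linear_scale[OF lin] grad_def inner_sum_left mult.commute)
  finally show ?thesis .
qed

lemma abs_powr_continuous_on:
  fixes f :: "'a::topological_space \<Rightarrow> real"
  shows "continuous_on S f \<Longrightarrow> 0 < r \<Longrightarrow> continuous_on S (\<lambda>x. \<bar>f x\<bar> powr r)"
  by (intro continuous_on_powr' continuous_on_rabs continuous_on_const) auto

lemma Cc_inf_abs_powr_integrable: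
  assumes "\<psi> \<in> Cc_inf \<Omega>" "0 < q"
  shows "integrable lborel (\<lambda>x. \<bar>\<psi> x\<bar> powr q)"
  using Cc_infD[OF assms(1)] assms(2)
  by (intro compact_support_integrable[of "closure {x. \<psi> x \<noteq> 0}"] abs_powr_continuous_on smooth_continuous_on)
    (auto intro: zero_outside_support)

lemma Cc_inf_grad_powr_integrable:
  assumes "\<psi> \<in> Cc_inf \<Omega>" "0 < p"
  shows "integrable lborel (\<lambda>x. norm (grad \<psi> x) powr p)"
  using Cc_infD[OF assms(1)] assms(2)
  by (intro compact_support_integrable[of "closure {x. \<psi> x \<noteq> 0}"] continuous_on_powr'
      continuous_on_norm smooth_grad_continuous continuous_on_const)
    (auto simp: grad_outside_support)

lemma Cc_inf_zero_outside: "\<psi> \<in> Cc_inf \<Omega> \<Longrightarrow> x \<notin> \<Omega> \<Longrightarrow> \<psi> x = 0"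
  by (metis Cc_infD(3) subsetD zero_outside_support)

lemma Cc_inf_set_integral:
  "\<psi> \<in> Cc_inf \<Omega> \<Longrightarrow> (LINT x:\<Omega>|lborel. \<bar>\<psi> x\<bar> powr q) = (LINT x|lborel. \<bar>\<psi> x\<bar> powr q)"
  by (rule set_integral_eq_integral_support) (simp add: Cc_inf_zero_outside)

lemma Cc_inf_set_integral_grad:
  "\<psi> \<in> Cc_inf \<Omega> \<Longrightarrow> (LINT x:\<Omega>|lborel. norm (grad \<psi> x) powr p) = (LINT x|lborel. norm (grad \<psi> x) powr p)"
  by (rule set_integral_eq_integral_support)
    (metis Cc_infD(3) subsetD grad_outside_support norm_zero powr_0)

lemma Cc_inf_cmult: "u \<in> Cc_inf \<Omega> \<Longrightarrow> c \<noteq> 0 \<Longrightarrow> (\<lambda>x. c * u x) \<in> Cc_inf \<Omega>"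
  by (simp add: Cc_inf_def smooth_mult[OF smooth_const])

lemma smooth_dist_square:
  fixes a :: "'a::euclidean_space"
  shows "smooth (\<lambda>x. (x - a) \<bullet> (x - a))"
proof -
  have "smooth (\<lambda>x. \<Sum>b\<in>Basis. (x \<bullet> b - a \<bullet> b) * (x \<bullet> b - a \<bullet> b))"
    by (intro smooth_sum smooth_mult smooth_diff smooth_inner smooth_const) simp
  also have "(\<lambda>x. \<Sum>b\<in>Basis. (x \<bullet> b - a \<bullet> b) * (x \<bullet> b - a \<bullet> b)) = (\<lambda>x. (x - a) \<bullet> (x - a))"
    by (rule ext, subst (3) euclidean_inner) (simp add: inner_diff_left)
  finally show ?thesis .
qed

text \<open>A bump built from the squared distance, which unlike the distance is smooth at the
  centre. Once normalised, it shows that the sets under \<open>Inf\<close> in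
  \<open>lambda_pq\<close> and \<open>pi_pq\<close> are nonempty, as every lower bound on these
  infima requires.\<close>

lemma ex_test_function:
  fixes \<Omega> :: "'a::euclidean_space set"
  assumes "open \<Omega>" "\<Omega> \<noteq> {}" "0 < q"
  obtains \<psi> where "\<psi> \<in> Cc_inf \<Omega>" "(LINT x:\<Omega>|lborel. \<bar>\<psi> x\<bar> powr q) > 0"
proof -
  obtain a \<rho> where a: "0 < \<rho>" "cball a \<rho> \<subseteq> \<Omega>"
    using assms open_contains_cball by (metis ex_in_conv)
  obtain h :: "real \<Rightarrow> real" where h: "smooth h" "\<And>x. x > 0 \<Longrightarrow> h x > 0" "\<And>x. x \<le> 0 \<Longrightarrow> h x = 0"
    using ex_smooth_positive by blast
  define \<psi> where "\<psi> x = h (\<rho>\<^sup>2 - (x - a) \<bullet> (x - a))" for x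
  have \<psi>: "\<psi> \<in> Cc_inf \<Omega>"
  proof (rule Cc_infI[of _ "cball a \<rho>"])
    show "smooth \<psi>"
      unfolding \<psi>_def by (intro smooth_compose[OF h(1)] smooth_diff smooth_const smooth_dist_square)
    show "\<psi> x = 0" if "x \<notin> cball a \<rho>" for x
    proof -
      have "\<rho>\<^sup>2 \<le> (norm (x - a))\<^sup>2"
        using that a by (intro power_mono) (auto simp: dist_norm norm_minus_commute)
      then show ?thesis by (simp add: \<psi>_def h(3) power2_norm_eq_inner)
    qed
  qed (use a in auto)
  have pos: "\<psi> x > 0" if "x \<in> ball a \<rho>" for x
  proof -
    have "(norm (x - a))\<^sup>2 < \<rho>\<^sup>2"
      using that by (intro power_strict_mono) (auto simp: dist_norm norm_minus_commute)
    then show ?thesis by (simp add: \<psi>_def h(2) power2_norm_eq_inner)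
  qed
  have "(LINT x|lborel. \<bar>\<psi> x\<bar> powr q) \<noteq> 0"
  proof
    assume "(LINT x|lborel. \<bar>\<psi> x\<bar> powr q) = 0"
    then have "AE x in lborel. \<bar>\<psi> x\<bar> powr q = 0"
      using integral_nonneg_eq_0_iff_AE[OF Cc_inf_abs_powr_integrable[OF \<psi> assms(3)]] by simp
    then have "AE x in lborel. x \<notin> ball a \<rho>"
      by (rule AE_mp) (use pos in \<open>force intro!: AE_I2\<close>)
    then have "emeasure lborel (ball a \<rho>) = 0"
      by (subst (asm) AE_iff_measurable[where N = "ball a \<rho>"]) auto
    then show False
      using a content_ball_pos[of \<rho> a] by (simp add: measure_def)
  qed
  moreover have "(LINT x|lborel. \<bar>\<psi> x\<bar> powr q) \<ge> 0" by simp
  ultimately show thesis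
    using that[OF \<psi>] Cc_inf_set_integral[OF \<psi>, of q] by linarith
qed

text \<open>Young's inequality for the product of \<open>y\<close> and
  \<open>c powr (s - 1)\<close>, with conjugate exponents \<open>s\<close> and
  \<open>s / (s - 1)\<close>. The left-hand side, as a function of \<open>y\<close>, is the tangent
  at \<open>c\<close>.\<close>

lemma powr_tangent:
  fixes s c y :: real
  assumes "1 < s" "0 < c" "0 \<le> y"
  shows "s * c powr (s - 1) * y - (s - 1) * c powr s \<le> y powr s"
proof -
  have "y * c powr (s - 1) \<le> y powr s / s + (c powr (s - 1)) powr (s / (s - 1)) / (s / (s - 1))"
    using assms by (intro Youngs_inequality) (auto simp: field_simps)
  also have "(c powr (s - 1)) powr (s / (s - 1)) = c powr s"
    using assms by (simp add: powr_powr)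
  finally show ?thesis
    using assms by (simp add: field_simps)
qed

subsection \<open>Integration along parallel lines\<close>

lemma integral_lborel_translate:
  fixes f :: "'a::euclidean_space \<Rightarrow> real"
  assumes [measurable]: "f \<in> borel_measurable borel"
  shows "(LINT x|lborel. f (x + c)) = (LINT x|lborel. f x)"
proof -
  have "(LINT x|lborel. f x) = (LINT x|distr lborel borel ((+) c). f x)"
    by (simp only: lborel_distr_plus)
  also have "\<dots> = (LINT x|lborel. f (c + x))"
    by (subst integral_distr) auto
  finally show ?thesis by (simp add: add.commute)
qed

lemma integral_unit_window:
  fixes n :: "'a::euclidean_space"
  assumes "norm n = 1"
  shows "integrable lborel (\<lambda>s. indicator {0..<1} ((x - s *\<^sub>R n) \<bullet> n) :: real)"
    and "(LINT s|lborel. indicator {0..<1} ((x - s *\<^sub>R n) \<bullet> n) :: real) = 1"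
proof -
  have "n \<bullet> n = 1" using assms by (simp add: norm_eq_1)
  then have eq: "(\<lambda>s. indicator {0..<1} ((x - s *\<^sub>R n) \<bullet> n) :: real) = indicator {x \<bullet> n - 1<..x \<bullet> n}"
    by (auto simp: fun_eq_iff indicator_def inner_diff_left)
  show "integrable lborel (\<lambda>s. indicator {0..<1} ((x - s *\<^sub>R n) \<bullet> n) :: real)"
    unfolding eq by (rule integrable_real_indicator) auto
  show "(LINT s|lborel. indicator {0..<1} ((x - s *\<^sub>R n) \<bullet> n) :: real) = 1"
    unfolding eq by simp
qed

text \<open>
  Weighting with the indicator of the slab \<open>0 \<le> x \<bullet> n < 1\<close>, which every line of direction \<open>n\<close>
  meets in unit length, avoids rotating the coordinates: only translation invariance is used.
\<close>

lemma integral_nonneg_along_lines: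
  fixes f :: "'a::euclidean_space \<Rightarrow> real"
  assumes f: "integrable lborel f" and n: "norm n = 1"
    and lines: "\<And>x. (LINT s|lborel. f (x + s *\<^sub>R n)) \<ge> 0"
  shows "(LINT x|lborel. f x) \<ge> 0"
proof -
  define w :: "'a \<Rightarrow> real" where "w x = indicator {0..<1} (x \<bullet> n)" for x
  have [measurable]: "f \<in> borel_measurable borel" using f by simp
  have [measurable]: "w \<in> borel_measurable borel" unfolding w_def by measurable
  have w: "integrable lborel (\<lambda>s. w (x - s *\<^sub>R n))" "(LINT s|lborel. w (x - s *\<^sub>R n)) = 1" for x
    unfolding w_def using integral_unit_window[OF n] by auto
  have w0: "w x \<ge> 0" for x by (simp add: w_def)
  have int1: "integrable (lborel \<Otimes>\<^sub>M lborel) (\<lambda>(x, s). w (x - s *\<^sub>R n) * f x)"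
  proof (rule lborel_pair.Fubini_integrable)
    show "(\<lambda>(x, s). w (x - s *\<^sub>R n) * f x) \<in> borel_measurable (lborel \<Otimes>\<^sub>M lborel)"
      by measurable
    have "(LINT s|lborel. norm (w (x - s *\<^sub>R n) * f x)) = norm (f x)" for x
      using w w0 by (simp add: abs_mult)
    with f show "integrable lborel (\<lambda>x. LINT s|lborel. norm (case (x, s) of (x, s) \<Rightarrow> w (x - s *\<^sub>R n) * f x))"
      by simp
    show "AE x in lborel. integrable lborel (\<lambda>s. case (x, s) of (x, s) \<Rightarrow> w (x - s *\<^sub>R n) * f x)"
      using w by simp
  qed
  have int2: "integrable (lborel \<Otimes>\<^sub>M lborel) (\<lambda>(s, x). w (x - s *\<^sub>R n) * f x)"
    using lborel_pair.integrable_product_swap[OF int1] by (simp add: case_prod_unfold)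
  \<comment> \<open>For fixed \<open>s\<close>, translation by \<open>s *\<^sub>R n\<close> moves
    the shift from the weight to \<open>f\<close>. The outer function \<open>g\<close> is used as
    the norm, for integrability, and as the identity, for the value.\<close>
  have shift: "(LINT x|lborel. g (w (x - s *\<^sub>R n) * f x)) = (LINT x|lborel. g (w x * f (x + s *\<^sub>R n)))"
    if [measurable]: "g \<in> borel_measurable borel" for s and g :: "real \<Rightarrow> real"
    using integral_lborel_translate[of "\<lambda>x. g (w (x - s *\<^sub>R n) * f x)" "s *\<^sub>R n"] by simp
  have int3: "integrable (lborel \<Otimes>\<^sub>M lborel) (\<lambda>(s, x). w x * f (x + s *\<^sub>R n))"
  proof (rule lborel_pair.Fubini_integrable)
    show "(\<lambda>(s, x). w x * f (x + s *\<^sub>R n)) \<in> borel_measurable (lborel \<Otimes>\<^sub>M lborel)"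
      by measurable
    have "integrable lborel (\<lambda>s. LINT x|lborel. norm (w (x - s *\<^sub>R n) * f x))"
      using lborel_pair.integrable_fst'[OF integrable_norm[OF int2]] by simp
    then show "integrable lborel (\<lambda>s. LINT x|lborel. norm (case (s, x) of (s, x) \<Rightarrow> w x * f (x + s *\<^sub>R n)))"
      using shift[of norm] by simp
    have "AE s in lborel. integrable lborel (\<lambda>x. w (x - s *\<^sub>R n) * f x)"
      using lborel_pair.AE_integrable_fst'[OF int2] by simp
    then show "AE s in lborel. integrable lborel (\<lambda>x. case (s, x) of (s, x) \<Rightarrow> w x * f (x + s *\<^sub>R n))"
    proof (rule AE_mp, intro AE_I2 impI)
      fix s assume "integrable lborel (\<lambda>x. w (x - s *\<^sub>R n) * f x)"
      then have "integrable (distr lborel borel ((+) (s *\<^sub>R n))) (\<lambda>x. w (x - s *\<^sub>R n) * f x)"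
        by (simp only: lborel_distr_plus)
      then have "integrable lborel (\<lambda>x. w (s *\<^sub>R n + x - s *\<^sub>R n) * f (s *\<^sub>R n + x))"
        by (subst (asm) integrable_distr_eq) auto
      then show "integrable lborel (\<lambda>x. case (s, x) of (s, x) \<Rightarrow> w x * f (x + s *\<^sub>R n))"
        by (simp add: add.commute)
    qed
  qed
  \<comment> \<open>A weight of total mass 1 is inserted, the integrals are exchanged, the shift is
    moved to \<open>f\<close>, and the integrals are exchanged back; the inner integral is then
    \<open>w x\<close> times a line integral of \<open>f\<close>.\<close>
  have "(LINT x|lborel. f x) = (LINT x|lborel. LINT s|lborel. w (x - s *\<^sub>R n) * f x)"
    using w by simp
  also have "\<dots> = (LINT s|lborel. LINT x|lborel. w (x - s *\<^sub>R n) * f x)"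
    using lborel_pair.Fubini_integral[OF int1] by simp
  also have "\<dots> = (LINT s|lborel. LINT x|lborel. w x * f (x + s *\<^sub>R n))"
    using shift[of "\<lambda>x. x"] by simp
  also have "\<dots> = (LINT x|lborel. LINT s|lborel. w x * f (x + s *\<^sub>R n))"
    using lborel_pair.Fubini_integral[OF int3] by simp
  also have "\<dots> \<ge> 0"
    by (rule integral_nonneg_AE) (use lines w0 in simp)
  finally show ?thesis .
qed

lemma integral_eq_0_along_lines:
  fixes f :: "'a::euclidean_space \<Rightarrow> real"
  assumes "integrable lborel f" "norm n = 1"
    and "\<And>x. (LINT s|lborel. f (x + s *\<^sub>R n)) = 0"
  shows "(LINT x|lborel. f x) = 0"
  using integral_nonneg_along_lines[of f n] integral_nonneg_along_lines[of "\<lambda>x. - f x" n] assms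
  by simp

subsection \<open>The one-dimensional inequality\<close>

lemma pi_pq_bdd_below:
  "bdd_below {(LINT x:{0<..<1}|lborel. \<bar>deriv u x\<bar> powr p) powr (1/p) | u.
        u \<in> Cc_inf {0<..<(1::real)} \<and> (LINT x:{0<..<1}|lborel. \<bar>u x\<bar> powr q) powr (1/q) = 1}"
  by (rule bdd_belowI[of _ 0]) auto

lemma set_integral_nonneg_pointwise:
  fixes f :: "'a \<Rightarrow> real"
  assumes "\<And>x. f x \<ge> 0"
  shows "(LINT x:A|M. f x) \<ge> 0"
  unfolding set_lebesgue_integral_def using assms by (intro integral_nonneg_AE AE_I2) simp

lemma normalising_factor:
  fixes X p q c :: real
  assumes "0 < X" "0 < q" "c = X powr (- 1 / q)"
  shows "0 < c" and "c powr q * X = 1" and "c powr p = 1 / X powr (p/q)"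
proof -
  show "0 < c" using assms by simp
  have "c powr q = X powr (- 1)" using assms by (simp add: powr_powr)
  then show "c powr q * X = 1" using assms by (simp add: powr_minus)
  have "c powr p = X powr (- (p / q))" using assms by (simp add: powr_powr)
  then show "c powr p = 1 / X powr (p/q)" by (simp add: powr_minus_divide)
qed

text \<open>The quotient is unchanged when \<open>u\<close> is multiplied by a positive constant, so
  a test function with positive \<open>q\<close>-integral can be rescaled into a competitor.\<close>

lemma pi_pq_normalise:
  assumes u: "u \<in> Cc_inf {0<..<1}" and q: "0 < q"
    and pos: "(LINT x:{0<..<1}|lborel. \<bar>u x\<bar> powr q) > 0"
  shows "((LINT x:{0<..<1}|lborel. \<bar>deriv u x\<bar> powr p) / (LINT x:{0<..<1}|lborel. \<bar>u x\<bar> powr q) powr (p/q)) powr (1/p)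
    \<in> {(LINT x:{0<..<1}|lborel. \<bar>deriv u x\<bar> powr p) powr (1/p) | u.
        u \<in> Cc_inf {0<..<(1::real)} \<and> (LINT x:{0<..<1}|lborel. \<bar>u x\<bar> powr q) powr (1/q) = 1}"
proof -
  define X where "X = (LINT x:{0<..<1}|lborel. \<bar>u x\<bar> powr q)"
  define c where "c = X powr (- 1 / q)"
  have "0 < X" using pos by (simp add: X_def)
  note c = normalising_factor[OF this q c_def]
  have cu: "(\<lambda>x. c * u x) \<in> Cc_inf {0<..<1}"
    using c by (intro Cc_inf_cmult u) simp
  have "(LINT x:{0<..<1}|lborel. \<bar>c * u x\<bar> powr q) = c powr q * X"
    using c(1) by (simp add: X_def abs_mult powr_mult set_lebesgue_integral_def mult.left_commute)
  then have norm1: "(LINT x:{0<..<1}|lborel. \<bar>c * u x\<bar> powr q) powr (1/q) = 1"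
    using c(2) by simp
  have "deriv (\<lambda>x. c * u x) x = c * deriv u x" for x
    using smooth_has_real_derivative[of u x] u
    by (intro DERIV_imp_deriv DERIV_cmult) (auto simp: Cc_inf_def)
  then have "(LINT x:{0<..<1}|lborel. \<bar>deriv (\<lambda>x. c * u x) x\<bar> powr p)
      = c powr p * (LINT x:{0<..<1}|lborel. \<bar>deriv u x\<bar> powr p)"
    using c(1) by (simp add: abs_mult powr_mult set_lebesgue_integral_def mult.left_commute)
  also have "\<dots> = (LINT x:{0<..<1}|lborel. \<bar>deriv u x\<bar> powr p) / X powr (p/q)"
    by (simp add: c(3))
  finally show ?thesis
    unfolding X_def[symmetric] by (intro CollectI exI[of _ "\<lambda>x. c * u x"] conjI cu norm1) simp
qed

lemma pi_pq_nonneg: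
  assumes "0 < q"
  shows "0 \<le> pi_pq p q"
  unfolding pi_pq_def
proof (rule cInf_greatest)
  obtain u where "u \<in> Cc_inf {0<..<1::real}" "(LINT x:{0<..<1}|lborel. \<bar>u x\<bar> powr q) > 0"
    using ex_test_function[of "{0<..<1::real}" q] assms by auto
  from pi_pq_normalise[OF this(1) assms this(2)]
  show "{(LINT x:{0<..<1}|lborel. \<bar>deriv u x\<bar> powr p) powr (1/p) | u.
      u \<in> Cc_inf {0<..<(1::real)} \<and> (LINT x:{0<..<1}|lborel. \<bar>u x\<bar> powr q) powr (1/q) = 1} \<noteq> {}"
    by (rule ex_in_conv[THEN iffD1, OF exI])
qed auto

lemma pi_pq_le:
  assumes u: "u \<in> Cc_inf {0<..<1}" and p: "0 < p" and q: "0 < q"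
    and pos: "(LINT x:{0<..<1}|lborel. \<bar>u x\<bar> powr q) > 0"
  shows "pi_pq p q powr p * (LINT x:{0<..<1}|lborel. \<bar>u x\<bar> powr q) powr (p/q)
        \<le> (LINT x:{0<..<1}|lborel. \<bar>deriv u x\<bar> powr p)"
proof -
  define X where "X = (LINT x:{0<..<1}|lborel. \<bar>u x\<bar> powr q)"
  define Y where "Y = (LINT x:{0<..<1}|lborel. \<bar>deriv u x\<bar> powr p)"
  have Y: "Y \<ge> 0" unfolding Y_def by (rule set_integral_nonneg_pointwise) simp
  have X: "X powr (p/q) > 0" using pos by (simp add: X_def)
  have "pi_pq p q \<le> (Y / X powr (p/q)) powr (1/p)"
    unfolding pi_pq_def X_def Y_def by (rule cInf_lower[OF pi_pq_normalise[OF u q pos] pi_pq_bdd_below])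
  then have "pi_pq p q powr p \<le> ((Y / X powr (p/q)) powr (1/p)) powr p"
    using pi_pq_nonneg[OF q] p by (intro powr_mono2) auto
  also have "\<dots> = Y / X powr (p/q)"
    using p Y by (simp add: powr_powr)
  finally show ?thesis
    using X by (simp only: pos_le_divide_eq X_def Y_def)
qed

lemma set_integral_open_interval:
  fixes f :: "real \<Rightarrow> real"
  assumes "continuous_on {a..b} f"
  shows "set_integrable lborel {a<..<b} f"
    and "(LINT t:{a<..<b}|lborel. f t) = integral {a..b} f"
proof -
  show "set_integrable lborel {a<..<b} f"
    by (rule set_integrable_subset[OF borel_integrable_atLeastAtMost'[OF assms]]) auto
  from set_borel_integral_eq_integral(2)[OF this]
  show "(LINT t:{a<..<b}|lborel. f t) = integral {a..b} f"
    by (simp add: integral_open_interval_real)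
qed

text \<open>
  The smooth substitute \<open>l - sqrt ((\<tau> - l)\<^sup>2 + e\<^sup>2)\<close>, with \<open>\<tau> = 2 l s\<close>, of the folding map
  \<open>l - |\<tau> - l|\<close>. Since it is 1-Lipschitz in \<open>\<tau>\<close>, composing with it does not increase the energy.
\<close>

definition fold_at :: "real \<Rightarrow> real \<Rightarrow> real \<Rightarrow> real" where
  "fold_at l e s = l - sqrt ((2 * l * s - l)\<^sup>2 + e\<^sup>2)"

definition fold_at' :: "real \<Rightarrow> real \<Rightarrow> real \<Rightarrow> real" where
  "fold_at' l e s = - (2 * l * (2 * l * s - l)) / sqrt ((2 * l * s - l)\<^sup>2 + e\<^sup>2)"

lemma fold_at_le: "0 < e \<Longrightarrow> fold_at l e s \<le> l - e"
  using real_sqrt_le_mono[of "e\<^sup>2" "(2 * l * s - l)\<^sup>2 + e\<^sup>2"] by (simp add: fold_at_def)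

lemma fold_at_le': "fold_at l e s \<le> l - \<bar>2 * l * s - l\<bar>"
  using real_sqrt_le_mono[of "(2 * l * s - l)\<^sup>2" "(2 * l * s - l)\<^sup>2 + e\<^sup>2"] by (simp add: fold_at_def)

lemma fold_at'_bound:
  assumes "0 < e" "0 < l"
  shows "\<bar>fold_at' l e s\<bar> \<le> 2 * l"
proof -
  have "\<bar>2 * l * s - l\<bar> \<le> sqrt ((2 * l * s - l)\<^sup>2 + e\<^sup>2)"
    using real_sqrt_le_mono[of "(2 * l * s - l)\<^sup>2" "(2 * l * s - l)\<^sup>2 + e\<^sup>2"] by simp
  moreover have "sqrt ((2 * l * s - l)\<^sup>2 + e\<^sup>2) > 0"
    using assms by (simp add: add_nonneg_pos)
  ultimately have "2 * l * (\<bar>2 * l * s - l\<bar> / sqrt ((2 * l * s - l)\<^sup>2 + e\<^sup>2)) \<le> 2 * l * 1"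
    using assms by (intro mult_left_mono) auto
  then show ?thesis
    using assms by (simp add: fold_at'_def abs_mult)
qed

lemma fold_at_deriv:
  assumes "0 < e"
  shows "(fold_at l e has_real_derivative fold_at' l e s) (at s)"
proof -
  have "(2 * l * s - l)\<^sup>2 + e\<^sup>2 > 0"
    using assms by (simp add: add_nonneg_pos)
  from DERIV_real_sqrt[OF this]
  have "(sqrt has_real_derivative inverse (sqrt ((2 * l * s - l)\<^sup>2 + e\<^sup>2)) / 2) (at ((2 * l * s - l)\<^sup>2 + e\<^sup>2))" .
  moreover have "((\<lambda>s. (2 * l * s - l)\<^sup>2 + e\<^sup>2) has_real_derivative 2 * (2 * l * (2 * l * s - l))) (at s)"
    by (auto intro!: derivative_eq_intros)
  ultimately have "((\<lambda>s. l - sqrt ((2 * l * s - l)\<^sup>2 + e\<^sup>2)) has_real_derivative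
      0 - inverse (sqrt ((2 * l * s - l)\<^sup>2 + e\<^sup>2)) / 2 * (2 * (2 * l * (2 * l * s - l)))) (at s)"
    by (intro DERIV_diff DERIV_const DERIV_chain2[where f = sqrt])
  moreover have "0 - inverse R / 2 * (2 * (2 * l * z)) = - (2 * l * z) / R" for R z :: real
    by (simp add: field_simps)
  moreover have "fold_at l e = (\<lambda>s. l - sqrt ((2 * l * s - l)\<^sup>2 + e\<^sup>2))"
    by (rule ext) (rule fold_at_def)
  ultimately show ?thesis
    by (simp only: fold_at'_def)
qed

lemma smooth_fold_at:
  assumes "0 < e"
  shows "smooth (fold_at l e)"
proof -
  have "smooth (\<lambda>s. l - sqrt ((2 * l * s - l) * (2 * l * s - l) + e * e))"
    using assms
    by (intro smooth_diff smooth_const smooth_sqrt smooth_add smooth_mult smooth_ident)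
      (auto simp: add_nonneg_pos)
  then show ?thesis by (simp add: fold_at_def[abs_def] power2_eq_square)
qed

text \<open>Substitution on each half of the unit interval, where the fold is monotone: it rises
  from a non-positive end value to its peak \<open>l - e\<close> and falls back. \<open>F\<close>
  vanishes on the negative part, so each half contributes the integral over
  \<open>{0..l - e}\<close>; the modulus compensates the change of sign of the derivative.\<close>

lemma has_integral_fold:
  fixes F :: "real \<Rightarrow> real"
  assumes F: "continuous_on UNIV F" "\<And>t. t \<le> 0 \<Longrightarrow> F t = 0" and e: "0 < e" "e < l"
  shows "((\<lambda>s. \<bar>fold_at' l e s\<bar> * F (fold_at l e s)) has_integral 2 * integral {0..l - e} F) {0..1}"
proof -
  \<comment> \<open>The common value at both ends; it is 0 for the sharp fold, and the rounding
    pushes it slightly below.\<close>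
  define a where "a = l - sqrt (l\<^sup>2 + e\<^sup>2)"
  have a0: "a \<le> 0"
    using real_sqrt_le_mono[of "l\<^sup>2" "l\<^sup>2 + e\<^sup>2"] e by (simp add: a_def)
  have ends: "fold_at l e 0 = a" "fold_at l e 1 = a" "fold_at l e (1/2) = l - e"
    using e by (auto simp: fold_at_def a_def power2_eq_square)
  have "fold_at l e s \<ge> a" if "s \<in> {0..1}" for s
  proof -
    have "\<bar>2 * l * s - l\<bar> \<le> l"
      using that e mult_left_mono[of s 1 "2 * l"] by (auto simp: abs_le_iff)
    then have "(2 * l * s - l)\<^sup>2 \<le> l\<^sup>2" by (metis abs_le_square_iff abs_of_nonneg abs_ge_zero order_trans)
    then show ?thesis by (simp add: fold_at_def a_def)
  qed
  then have range: "fold_at l e ` {0..1} \<subseteq> {a..l - e}"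
    using fold_at_le[OF e(1)] by auto
  have cF: "continuous_on S F" for S using F(1) continuous_on_subset by blast
  have "integral {a..l - e} F = integral {a..0} F + integral {0..l - e} F"
    using a0 e by (intro Henstock_Kurzweil_Integration.integral_combine[symmetric] integrable_continuous_real cF) auto
  also have "integral {a..0} F = 0"
    using F(2) Henstock_Kurzweil_Integration.integral_cong[of "{a..0}" F "\<lambda>_. 0"] by simp
  finally have I: "integral {a..l - e} F = integral {0..l - e} F" by simp
  have "((\<lambda>s. fold_at' l e s *\<^sub>R F (fold_at l e s)) has_integral
      (integral {fold_at l e 0..fold_at l e (1/2)} F - integral {fold_at l e (1/2)..fold_at l e 0} F)) {0..1/2}"
    using range
    by (intro has_integral_substitution_general[of "{}" _ _ _ a "l - e"] cF
        smooth_continuous_on[OF smooth_fold_at[OF e(1)]] DERIV_subset[OF fold_at_deriv[OF e(1)]]) auto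
  then have 1: "((\<lambda>s. fold_at' l e s * F (fold_at l e s)) has_integral integral {0..l - e} F) {0..1/2}"
    using a0 e by (simp add: ends I)
  have "((\<lambda>s. fold_at' l e s *\<^sub>R F (fold_at l e s)) has_integral
      (integral {fold_at l e (1/2)..fold_at l e 1} F - integral {fold_at l e 1..fold_at l e (1/2)} F)) {1/2..1}"
    using range
    by (intro has_integral_substitution_general[of "{}" _ _ _ a "l - e"] cF
        smooth_continuous_on[OF smooth_fold_at[OF e(1)]] DERIV_subset[OF fold_at_deriv[OF e(1)]]) auto
  then have 2: "((\<lambda>s. fold_at' l e s * F (fold_at l e s)) has_integral - integral {0..l - e} F) {1/2..1}"
    using a0 e by (simp add: ends I)
  have "((\<lambda>s. \<bar>fold_at' l e s\<bar> * F (fold_at l e s)) has_integral integral {0..l - e} F) {0..1/2}"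
  proof (rule has_integral_eq[OF _ 1])
    fix s :: real assume "s \<in> {0..1/2}"
    then have "l * (2 * l * s - l) \<le> 0"
      using e by (intro mult_nonneg_nonpos) (auto simp: mult.assoc)
    then have "fold_at' l e s \<ge> 0" by (auto simp: fold_at'_def intro!: divide_nonpos_nonneg)
    then show "fold_at' l e s * F (fold_at l e s) = \<bar>fold_at' l e s\<bar> * F (fold_at l e s)" by simp
  qed
  moreover have "((\<lambda>s. \<bar>fold_at' l e s\<bar> * F (fold_at l e s)) has_integral integral {0..l - e} F) {1/2..1}"
  proof (rule has_integral_eq[OF _ has_integral_neg[OF 2, simplified]])
    fix s :: real assume "s \<in> {1/2..1}"
    then have "0 \<le> l * (2 * l * s - l)"
      using e by (intro mult_nonneg_nonneg) (auto simp: mult.assoc)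
    then have "fold_at' l e s \<le> 0" by (auto simp: fold_at'_def)
    then show "- (fold_at' l e s * F (fold_at l e s)) = \<bar>fold_at' l e s\<bar> * F (fold_at l e s)" by simp
  qed
  ultimately show ?thesis
    using has_integral_combine[of 0 "1/2" 1] by fastforce
qed

text \<open>The competitor for \<open>pi_pq\<close> is \<open>v\<close> composed with the rounded
  fold, that is, \<open>v\<close> reflected to an interval of length \<open>2 * l\<close> and
  rescaled to length 1. It vanishes near both ends because the fold stays below \<eta> there. The
  range of integration stops at \<open>l - e\<close>, the peak of the rounded fold.\<close>

lemma one_dim_aux:
  assumes v: "smooth v" "0 < \<eta>" "\<And>t. t \<le> \<eta> \<Longrightarrow> v t = 0" and e: "0 < e" "e < l" and pq: "1 \<le> p" "0 < q"
  shows "pi_pq p q powr p * (integral {0..l - e} (\<lambda>t. \<bar>v t\<bar> powr q) / l) powr (p/q)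
      \<le> (2 * l) powr (p - 1) * (2 * integral {0..l - e} (\<lambda>t. \<bar>deriv v t\<bar> powr p))"
    (is "?c * (?X / l) powr _ \<le> ?L * (2 * ?D)")
proof (cases "?X > 0")
  case X: True
  have l: "l > 0" using e by simp
  define w where "w s = v (fold_at l e s)" for s
  have sw: "smooth w"
    unfolding w_def using smooth_compose[OF v(1) smooth_fold_at[OF e(1)]] .
  have \<eta>l: "\<eta> / (2 * l) > 0" using v(2) l by simp
  have w: "w \<in> Cc_inf {0<..<1}"
  proof (rule Cc_infI[of _ "{\<eta> / (2 * l)..1 - \<eta> / (2 * l)}"])
    show "w s = 0" if "s \<notin> {\<eta> / (2 * l)..1 - \<eta> / (2 * l)}" for s
    proof -
      have "2 * l * s < \<eta> \<or> 2 * l - \<eta> < 2 * l * s"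
        using that l by (auto simp: field_simps)
      then have "l - \<bar>2 * l * s - l\<bar> \<le> \<eta>" by linarith
      then have "fold_at l e s \<le> \<eta>" using fold_at_le' order_trans by blast
      then show ?thesis by (simp add: w_def v(3))
    qed
  qed (use sw \<eta>l in auto)
  have dw: "deriv w s = deriv v (fold_at l e s) * fold_at' l e s" for s
    unfolding w_def
    by (intro DERIV_imp_deriv DERIV_chain2 smooth_has_real_derivative v fold_at_deriv e)
  have dv0: "deriv v t = 0" if "t \<le> 0" for t
  proof -
    have "\<forall>\<^sub>F s in nhds t. v s = 0"
      using eventually_nhds_in_open[of "{..<\<eta>}" t] that v by (auto elim!: eventually_mono)
    then have "(v has_real_derivative 0) (at t)"
      by (subst DERIV_cong_ev[OF refl _ refl]) auto
    then show ?thesis by (rule DERIV_imp_deriv)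
  qed
  have cont: "continuous_on S (\<lambda>t. \<bar>v t\<bar> powr q)" "continuous_on S (\<lambda>t. \<bar>deriv v t\<bar> powr p)"
    "continuous_on S (\<lambda>t. \<bar>w t\<bar> powr q)" "continuous_on S (\<lambda>t. \<bar>deriv w t\<bar> powr p)" for S
    using pq v(1) sw
    by (simp_all add: abs_powr_continuous_on smooth_continuous_on smooth_deriv)
  define Q where "Q = (LINT s:{0<..<1}|lborel. \<bar>w s\<bar> powr q)"
  define P where "P = (LINT s:{0<..<1}|lborel. \<bar>deriv w s\<bar> powr p)"
  have Q: "Q = integral {0..1} (\<lambda>s. \<bar>w s\<bar> powr q)"
    and P: "P = integral {0..1} (\<lambda>s. \<bar>deriv w s\<bar> powr p)"
    unfolding Q_def P_def by (intro set_integral_open_interval cont)+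
  have foldv: "((\<lambda>s. \<bar>fold_at' l e s\<bar> * \<bar>w s\<bar> powr q) has_integral 2 * ?X) {0..1}"
    unfolding w_def using v e pq by (intro has_integral_fold cont) auto
  have foldd: "((\<lambda>s. \<bar>fold_at' l e s\<bar> * \<bar>deriv v (fold_at l e s)\<bar> powr p) has_integral 2 * ?D) {0..1}"
    using dv0 e pq by (intro has_integral_fold cont) auto
  \<comment> \<open>Replacing the Jacobian by its bound \<open>2 * l\<close> only enlarges the
    \<open>q\<close>-integral, which is the direction needed to bound \<open>Q\<close> from
    below.\<close>
  have "2 * ?X \<le> 2 * l * Q"
  proof (rule has_integral_le[OF foldv])
    show "((\<lambda>s. 2 * l * \<bar>w s\<bar> powr q) has_integral 2 * l * Q) {0..1}"
      unfolding Q by (intro has_integral_mult_right integrable_integral integrable_continuous_real cont)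
  qed (intro mult_right_mono fold_at'_bound e l, simp)
  then have XQ: "?X / l \<le> Q"
    using l by (simp add: field_simps)
  have "P \<le> ?L * (2 * ?D)"
  proof (rule has_integral_le[OF _ has_integral_mult_right[OF foldd]])
    show "((\<lambda>s. \<bar>deriv w s\<bar> powr p) has_integral P) {0..1}"
      unfolding P by (intro integrable_integral integrable_continuous_real cont)
    fix s :: real
    \<comment> \<open>Of the \<open>p\<close> factors that the chain rule produces, one is kept as
      the Jacobian for the substitution and the other \<open>p - 1\<close> are bounded by
      \<open>2 * l\<close>.\<close>
    have "\<bar>fold_at' l e s\<bar> powr p = \<bar>fold_at' l e s\<bar> powr (p - 1) * \<bar>fold_at' l e s\<bar>"
      using powr_add[of "\<bar>fold_at' l e s\<bar>" "p - 1" 1] by simp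
    also have "\<dots> \<le> ?L * \<bar>fold_at' l e s\<bar>"
      using pq fold_at'_bound[OF e(1) l] by (intro mult_right_mono powr_mono2) auto
    finally have "\<bar>deriv v (fold_at l e s)\<bar> powr p * \<bar>fold_at' l e s\<bar> powr p
        \<le> \<bar>deriv v (fold_at l e s)\<bar> powr p * (?L * \<bar>fold_at' l e s\<bar>)"
      by (rule mult_left_mono) simp
    then show "\<bar>deriv w s\<bar> powr p \<le> ?L * (\<bar>fold_at' l e s\<bar> * \<bar>deriv v (fold_at l e s)\<bar> powr p)"
      by (simp add: dw abs_mult powr_mult mult.commute mult.left_commute)
  qed
  moreover have "Q > 0" using XQ X l by (meson divide_pos_pos less_le_trans)
  then have "?c * Q powr (p/q) \<le> P"
    using pi_pq_le[OF w] pq by (auto simp: P_def Q_def)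
  moreover have "?c * (?X / l) powr (p/q) \<le> ?c * Q powr (p/q)"
    using XQ X l pq by (intro mult_left_mono powr_mono2) auto
  ultimately show ?thesis by linarith
next
  case False
  \<comment> \<open>Then \<open>?X = 0\<close>, and the left-hand side is 0 since
    \<open>0 powr _ = 0\<close>; \<open>pi_pq_le\<close> would need a positive integral.\<close>
  have "?X \<ge> 0" by (intro integral_nonneg integrable_continuous_real abs_powr_continuous_on
      smooth_continuous_on v pq) auto
  moreover have "?D \<ge> 0"
    using pq by (intro integral_nonneg integrable_continuous_real abs_powr_continuous_on
      smooth_continuous_on smooth_deriv v) auto
  ultimately show ?thesis using False by simp
qed

text \<open>The limit of vanishing rounding. Only the left-hand side needs continuity in the upper
  end; on the right the energy over \<open>{0..l - e}\<close> is at most that over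
  \<open>{0..l}\<close>. The two halves of the reflection and the doubled length give
  \<open>2 * (2 * l) powr (p - 1) = 2 powr p * l powr (p - 1)\<close>, the source of the 2 in
  \<open>pi_pq p q / 2\<close>.\<close>

lemma one_dim_inequality:
  assumes v: "smooth v" "0 < \<eta>" "\<And>t. t \<le> \<eta> \<Longrightarrow> v t = 0" and l: "0 < l" and pq: "1 \<le> p" "0 < q"
  shows "(pi_pq p q / 2) powr p * (l powr (1 - p) * ((LINT t:{0<..<l}|lborel. \<bar>v t\<bar> powr q) / l) powr (p/q))
      \<le> (LINT t:{0<..<l}|lborel. \<bar>deriv v t\<bar> powr p)"
proof -
  define X where "X x = integral {0..x} (\<lambda>t. \<bar>v t\<bar> powr q)" for x
  define D where "D x = integral {0..x} (\<lambda>t. \<bar>deriv v t\<bar> powr p)" for x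
  have cont: "continuous_on S (\<lambda>t. \<bar>v t\<bar> powr q)" "continuous_on S (\<lambda>t. \<bar>deriv v t\<bar> powr p)" for S
    using pq v(1) by (simp_all add: abs_powr_continuous_on smooth_continuous_on smooth_deriv)
  have XD: "(LINT t:{0<..<l}|lborel. \<bar>v t\<bar> powr q) = X l"
    "(LINT t:{0<..<l}|lborel. \<bar>deriv v t\<bar> powr p) = D l"
    unfolding X_def D_def by (intro set_integral_open_interval cont)+
  have X0: "X x \<ge> 0" for x
    unfolding X_def by (intro integral_nonneg integrable_continuous_real cont) auto
  define e where "e n = l / 2 * inverse (real (Suc n))" for n :: nat
  define x where "x n = l - e n" for n
  have e: "0 < e n" "e n < l" for n
  proof -
    show "0 < e n" using l by (simp add: e_def)
    have "e n \<le> l / 2 * 1"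
      unfolding e_def using l by (intro mult_left_mono) (auto simp: field_simps)
    then show "e n < l" using l by simp
  qed
  have x: "x n \<in> {0..l}" for n
    using e[of n] by (simp add: x_def)
  have "e \<longlonglongrightarrow> 0"
    unfolding e_def using tendsto_mult_left[OF LIMSEQ_inverse_real_of_nat, of "l / 2"] by simp
  then have xl: "x \<longlonglongrightarrow> l"
    unfolding x_def using tendsto_diff[OF tendsto_const[of l]] by fastforce
  have "continuous_on {0..l} X"
    unfolding X_def by (intro indefinite_integral_continuous_1 integrable_continuous_real cont)
  then have "(\<lambda>n. X (x n)) \<longlonglongrightarrow> X l"
    by (rule continuous_on_tendsto_compose[OF _ xl]) (use l x in auto)
  then have "(\<lambda>n. pi_pq p q powr p * (X (x n) / l) powr (p/q)) \<longlonglongrightarrow> pi_pq p q powr p * (X l / l) powr (p/q)"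
    using l pq X0
    by (intro tendsto_mult tendsto_const tendsto_powr' tendsto_divide) auto
  then have "pi_pq p q powr p * (X l / l) powr (p/q) \<le> (2 * l) powr (p - 1) * (2 * D l)"
  proof (rule LIMSEQ_le_const2, intro exI allI impI)
    fix n :: nat
    have "pi_pq p q powr p * (X (x n) / l) powr (p/q) \<le> (2 * l) powr (p - 1) * (2 * D (x n))"
      unfolding X_def D_def x_def by (rule one_dim_aux[OF v e pq])
    also have "D (x n) \<le> D l"
      unfolding D_def using x[of n]
      by (intro integral_subset_le integrable_continuous_real cont) auto
    finally show "pi_pq p q powr p * (X (x n) / l) powr (p/q) \<le> (2 * l) powr (p - 1) * (2 * D l)"
      by (simp add: mult_left_mono)
  qed
  also have "(2 * l) powr (p - 1) * (2 * D l) = 2 powr p * l powr (p - 1) * D l"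
    using l powr_add[of 2 "p - 1" 1] by (simp add: powr_mult)
  finally have "pi_pq p q powr p * (X l / l) powr (p/q) / (2 powr p * l powr (p - 1)) \<le> D l"
    using l by (simp add: field_simps)
  also have "pi_pq p q powr p * (X l / l) powr (p/q) / (2 powr p * l powr (p - 1)) =
      (pi_pq p q / 2) powr p * (l powr (1 - p) * (X l / l) powr (p/q))"
    using l pi_pq_nonneg[of q p] pq powr_minus_divide[of l "p - 1"] by (simp add: powr_divide)
  finally show ?thesis by (simp add: XD)
qed

subsection \<open>Half-spaces and nearest-facet cells\<close>

text \<open>The previous bound reads \<open>M / l powr p * l * (X / l) powr (p/q)\<close>, a power
  of the mean \<open>X / l\<close> weighted by the length. Since \<open>l \<le> r\<close>, the
  factor \<open>1 / l powr p\<close> may be lowered to \<open>1 / r powr p\<close>, and the tangent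
  at \<open>c\<close> then makes everything linear in \<open>X\<close> and \<open>l\<close>, with
  coefficients \<open>A\<close> and \<open>B\<close> that are the same for all segments.\<close>

lemma one_dim_linearised:
  assumes v: "smooth v" "0 < \<eta>" "\<And>t. t \<le> \<eta> \<Longrightarrow> v t = 0"
    and l: "0 < l" "l \<le> r" and pq: "1 \<le> q" "q < p" and c: "0 < c"
    and A: "A = (pi_pq p q / 2) powr p / r powr p * (p/q * c powr (p/q - 1))"
    and B: "B = (pi_pq p q / 2) powr p / r powr p * ((p/q - 1) * c powr (p/q))"
  shows "A * (LINT t:{0<..<l}|lborel. \<bar>v t\<bar> powr q) \<le> (LINT t:{0<..<l}|lborel. \<bar>deriv v t\<bar> powr p) + B * l"
proof -
  define X where "X = (LINT t:{0<..<l}|lborel. \<bar>v t\<bar> powr q)"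
  define M where "M = (pi_pq p q / 2) powr p"
  define T where "T = p/q * c powr (p/q - 1) * (X / l) - (p/q - 1) * c powr (p/q)"
  have X: "X \<ge> 0" unfolding X_def by (rule set_integral_nonneg_pointwise) simp
  have "A * X - B * l = M / r powr p * l * T"
    using l by (simp add: A B M_def T_def field_simps)
  also have "\<dots> \<le> M / r powr p * l * (X / l) powr (p/q)"
    unfolding T_def using powr_tangent[of "p/q" c "X / l"] X l pq c
    by (intro mult_left_mono) (auto simp: M_def)
  also have "\<dots> \<le> M / l powr p * l * (X / l) powr (p/q)"
    using l pq by (intro mult_right_mono divide_left_mono powr_mono2) (auto simp: M_def)
  also have "\<dots> = M * (l powr (1 - p) * (X / l) powr (p/q))"
    using l by (simp add: powr_diff)
  also have "\<dots> \<le> (LINT t:{0<..<l}|lborel. \<bar>deriv v t\<bar> powr p)"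
    unfolding M_def X_def by (rule one_dim_inequality[OF v l(1)]) (use pq in auto)
  finally show ?thesis by (simp add: X_def)
qed

definition halfspaces :: "(nat \<Rightarrow> 'a::euclidean_space) \<Rightarrow> (nat \<Rightarrow> real) \<Rightarrow> nat \<Rightarrow> 'a set" where
  "halfspaces n b m = {x. \<forall>j<m. n j \<bullet> x < b j}"

text \<open>The points whose nearest facet is the \<open>i\<close>-th one, ties being broken in favour of the smallest index.\<close>

definition cell :: "(nat \<Rightarrow> 'a::euclidean_space) \<Rightarrow> (nat \<Rightarrow> real) \<Rightarrow> nat \<Rightarrow> nat \<Rightarrow> 'a set" where
  "cell n b m i = {x \<in> halfspaces n b m. (\<forall>j<m. b i - n i \<bullet> x \<le> b j - n j \<bullet> x)
      \<and> (\<forall>j<i. b i - n i \<bullet> x < b j - n j \<bullet> x)}"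

lemma cell_borel: "cell n b m i \<in> sets borel"
proof -
  have "{x \<in> space borel. (\<forall>j<m. n j \<bullet> x < b j) \<and> (\<forall>j<m. b i - n i \<bullet> x \<le> b j - n j \<bullet> x)
      \<and> (\<forall>j<i. b i - n i \<bullet> x < b j - n j \<bullet> x)} \<in> sets borel"
    by measurable
  then show ?thesis by (simp add: cell_def halfspaces_def)
qed

lemma open_halfspaces: "open (halfspaces n b m)"
proof -
  have "halfspaces n b m = (\<Inter>j\<in>{..<m}. {x. n j \<bullet> x < b j})"
    by (auto simp: halfspaces_def)
  then show ?thesis by (simp add: open_INT open_halfspace_lt)
qed

lemma convex_halfspaces: "convex (halfspaces n b m)"
proof -
  have "halfspaces n b m = (\<Inter>j\<in>{..<m}. {x. n j \<bullet> x < b j})"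
    by (auto simp: halfspaces_def)
  then show ?thesis by (simp add: convex_INT convex_halfspace_lt)
qed

lemma UN_cell:
  assumes "m > 0"
  shows "(\<Union>i<m. cell n b m i) = halfspaces n b m"
proof (intro equalityI subsetI)
  fix x assume x: "x \<in> halfspaces n b m"
  define d where "d j = b j - n j \<bullet> x" for j
  have "\<exists>i<m. \<forall>j<m. d i \<le> d j"
  proof -
    have "Min (d ` {..<m}) \<in> d ` {..<m}" using assms by (intro Min_in) auto
    then obtain i where "i < m" "d i = Min (d ` {..<m})" by auto
    then show ?thesis by auto
  qed
  \<comment> \<open>The least index among the minimisers, which is the one that the tie-breaking
    rule selects.\<close>
  then obtain i where i: "i < m" "\<forall>j<m. d i \<le> d j"
    and least: "\<And>k. k < i \<Longrightarrow> \<not> (k < m \<and> (\<forall>j<m. d k \<le> d j))"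
    using exists_least_iff[of "\<lambda>i. i < m \<and> (\<forall>j<m. d i \<le> d j)"] by blast
  have "d i < d j" if "j < i" for j
  proof (rule ccontr)
    assume "\<not> d i < d j"
    then have "\<forall>k<m. d j \<le> d k" using i by force
    with least[OF that] i(1) that show False by simp
  qed
  with i x show "x \<in> (\<Union>i<m. cell n b m i)" by (auto simp: cell_def d_def)
qed (auto simp: cell_def)

lemma disjoint_cells: "disjoint_family_on (cell n b m) {..<m}"
  unfolding disjoint_family_on_def
proof (intro ballI impI)
  fix i j assume ij: "i \<in> {..<m}" "j \<in> {..<m}" "i \<noteq> j"
  show "cell n b m i \<inter> cell n b m j = {}"
  proof (rule ccontr)
    assume "cell n b m i \<inter> cell n b m j \<noteq> {}"
    then obtain x where "x \<in> cell n b m i" "x \<in> cell n b m j" by blast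
    then have "b i - n i \<bullet> x \<le> b j - n j \<bullet> x" "b j - n j \<bullet> x \<le> b i - n i \<bullet> x"
      "i < j \<longrightarrow> b j - n j \<bullet> x < b i - n i \<bullet> x" "j < i \<longrightarrow> b i - n i \<bullet> x < b j - n j \<bullet> x"
      using ij by (auto simp: cell_def)
    with ij(3) show False by linarith
  qed
qed

text \<open>For a unit normal, the slack \<open>b j - n j \<bullet> x\<close> is the distance from
  \<open>x\<close> to the \<open>j\<close>-th bounding hyperplane.\<close>

lemma ball_subset_halfspaces:
  assumes "\<And>j. j < m \<Longrightarrow> norm (n j) = 1" "\<And>j. j < m \<Longrightarrow> d \<le> b j - n j \<bullet> x"
  shows "ball x d \<subseteq> halfspaces n b m"
proof
  fix y assume y: "y \<in> ball x d"
  show "y \<in> halfspaces n b m"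
    unfolding halfspaces_def
  proof (intro CollectI allI impI)
    fix j assume j: "j < m"
    have "n j \<bullet> (y - x) \<le> norm (n j) * norm (y - x)" by (rule norm_cauchy_schwarz)
    also have "\<dots> < d" using y assms(1)[OF j] by (simp add: dist_norm norm_minus_commute)
    finally show "n j \<bullet> y < b j" using assms(2)[OF j] by (simp add: inner_diff_right)
  qed
qed

text \<open>A move by \<open>s\<close> towards facet \<open>i\<close> lowers the distance to it by
  exactly \<open>s\<close>, and the distance to any other facet by at most \<open>s\<close> because
  the normals are unit vectors. Hence facet \<open>i\<close> remains the nearest, with all strict
  inequalities preserved, and the cell meets the line in a segment reaching down to the
  facet.\<close>

lemma cell_line:
  assumes norm1: "\<And>j. j < m \<Longrightarrow> norm (n j) = 1" and i: "i < m"
    and x: "x \<in> cell n b m i" and s: "0 \<le> s" "s < b i - n i \<bullet> x"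
  shows "x + s *\<^sub>R n i \<in> cell n b m i"
proof -
  have le: "n j \<bullet> (x + s *\<^sub>R n i) \<le> n j \<bullet> x + s" if "j < m" for j
  proof -
    have "n j \<bullet> n i \<le> norm (n j) * norm (n i)" by (rule norm_cauchy_schwarz)
    also have "\<dots> = 1" using norm1 that i by simp
    finally have "s * (n j \<bullet> n i) \<le> s * 1" using s by (intro mult_left_mono)
    then show ?thesis by (simp add: inner_add_right)
  qed
  have "n i \<bullet> n i = 1" using norm1[OF i] by (simp add: norm_eq_1)
  then have eq: "n i \<bullet> (x + s *\<^sub>R n i) = n i \<bullet> x + s" by (simp add: inner_add_right)
  have 1: "b i - n i \<bullet> x \<le> b j - n j \<bullet> x" if "j < m" for j
    using x that by (simp add: cell_def)
  have 2: "b i - n i \<bullet> x < b j - n j \<bullet> x" if "j < i" for j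
    using x that by (simp add: cell_def)
  show ?thesis
    unfolding cell_def halfspaces_def
  proof (intro CollectI conjI allI impI)
    fix j assume "j < m"
    from le[OF this] 1[OF this] s eq
    show "n j \<bullet> (x + s *\<^sub>R n i) < b j"
      "b i - n i \<bullet> (x + s *\<^sub>R n i) \<le> b j - n j \<bullet> (x + s *\<^sub>R n i)" by linarith+
  next
    fix j assume "j < i"
    then have "j < m" using i by simp
    from le[OF this] 2[OF \<open>j < i\<close>] eq
    show "b i - n i \<bullet> (x + s *\<^sub>R n i) < b j - n j \<bullet> (x + s *\<^sub>R n i)" by linarith
  qed
qed

text \<open>Each boundary point is strictly separated from the convex hull of \<open>K\<close>, and
  compactness of the boundary leaves finitely many separating half-spaces. Their intersection misses
  the boundary, meets \<Omega> and is connected, so it cannot leave \<Omega>.\<close>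

lemma ex_halfspaces_between:
  fixes \<Omega> :: "'a::euclidean_space set"
  assumes \<Omega>: "open \<Omega>" "bounded \<Omega>" "convex \<Omega>" and K: "compact K" "K \<subseteq> \<Omega>" "K \<noteq> {}"
  shows "\<exists>m>0. \<exists>n b. (\<forall>j<m. norm (n j) = 1) \<and> K \<subseteq> halfspaces n b m \<and> halfspaces n b m \<subseteq> \<Omega>"
proof -
  define C where "C = convex hull K"
  have C: "compact C" "convex C" "C \<subseteq> \<Omega>" "K \<subseteq> C"
    using K \<Omega> by (auto simp: C_def compact_convex_hull convex_convex_hull hull_minimal hull_subset)
  have "\<exists>a \<beta>. norm a = 1 \<and> a \<bullet> y > \<beta> \<and> (\<forall>x\<in>C. a \<bullet> x < \<beta>)" if "y \<in> frontier \<Omega>" for y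
  proof -
    have "y \<notin> C" using that \<Omega>(1) C(3) by (auto simp: frontier_def interior_open)
    then obtain a \<beta> where ab: "a \<bullet> y < \<beta>" "\<forall>x\<in>C. a \<bullet> x > \<beta>"
      using separating_hyperplane_closed_point[of C y] C by (auto simp: compact_imp_closed)
    obtain x where "x \<in> C" using K C by auto
    then have "a \<noteq> 0" using ab by force
    \<comment> \<open>The separating functional is reversed, so that \<open>C\<close> is on the side
      of smaller values, and scaled to a unit normal.\<close>
    then show ?thesis
      using ab by (intro exI[of _ "- (a /\<^sub>R norm a)"] exI[of _ "- (\<beta> / norm a)"])
        (auto simp: divide_simps)
  qed
  then obtain a \<beta> where ab: "\<And>y. y \<in> frontier \<Omega> \<Longrightarrow> norm (a y) = 1"
    "\<And>y. y \<in> frontier \<Omega> \<Longrightarrow> a y \<bullet> y > \<beta> y"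
    "\<And>y x. y \<in> frontier \<Omega> \<Longrightarrow> x \<in> C \<Longrightarrow> a y \<bullet> x < \<beta> y"
    by metis
  have "compact (frontier \<Omega>)" using \<Omega>(2) by (rule compact_frontier_bounded)
  then obtain D where D: "D \<subseteq> frontier \<Omega>" "finite D" "frontier \<Omega> \<subseteq> (\<Union>y\<in>D. {x. a y \<bullet> x > \<beta> y})"
    by (rule compactE_image[of _ "frontier \<Omega>" "\<lambda>y. {x. a y \<bullet> x > \<beta> y}"])
      (use ab in \<open>auto simp: open_halfspace_gt\<close>)
  obtain m e where e: "D = e ` {i::nat. i < m}"
    using finite_imp_nat_seg_image_inj_on[OF D(2)] by blast
  define H where "H = halfspaces (a \<circ> e) (\<beta> \<circ> e) m"
  have KH: "K \<subseteq> H"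
    using ab(3) D(1) e C(4) by (auto simp: H_def halfspaces_def)
  have "H \<inter> frontier \<Omega> = {}"
    using D(3) e by (fastforce simp: H_def halfspaces_def)
  moreover have "connected H"
    unfolding H_def by (intro convex_connected convex_halfspaces)
  moreover have "H \<inter> \<Omega> \<noteq> {}" using KH K by auto
  ultimately have H\<Omega>: "H \<subseteq> \<Omega>"
    using connected_Int_frontier[of H \<Omega>] by blast
  have "m > 0"
  proof (rule ccontr)
    assume "\<not> m > 0"
    then have "H = UNIV" by (auto simp: H_def halfspaces_def)
    then show False using H\<Omega> \<Omega>(2) not_bounded_UNIV by (metis bounded_subset)
  qed
  moreover have "norm ((a \<circ> e) j) = 1" if "j < m" for j
    using ab(1) D(1) e that by auto
  ultimately show ?thesis using KH H\<Omega> unfolding H_def by blast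
qed

lemma ball_le_inradius:
  fixes \<Omega> :: "'a::euclidean_space set"
  assumes "bounded \<Omega>" "0 < d" "ball x d \<subseteq> \<Omega>"
  shows "d \<le> inradius \<Omega>"
  unfolding inradius_def
proof (rule cSup_upper)
  show "d \<in> {r. r > 0 \<and> (\<exists>x0\<in>\<Omega>. ball x0 r \<subseteq> \<Omega>)}"
    using assms centre_in_ball by blast
  show "bdd_above {r. r > 0 \<and> (\<exists>x0\<in>\<Omega>. ball x0 r \<subseteq> \<Omega>)}"
  proof (rule bdd_aboveI)
    fix r assume "r \<in> {r. r > 0 \<and> (\<exists>x0\<in>\<Omega>. ball x0 r \<subseteq> \<Omega>)}"
    then obtain x0 where r: "r > 0" "ball x0 r \<subseteq> \<Omega>" by auto
    then have "diameter (ball x0 r) \<le> diameter \<Omega>"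
      using assms(1) by (intro diameter_subset)
    then show "r \<le> diameter \<Omega>" using r(1) by (simp add: diameter_ball)
  qed
qed

text \<open>The linearised inequality is integrated over all lines parallel to the normal of facet
  \<open>i\<close>. Only the derivative in that direction enters, and it is bounded by the full
  gradient at the very end. The term \<open>B * l\<close> integrates to \<open>B\<close> times the
  volume of the cell.\<close>

lemma cell_inequality:
  fixes n :: "nat \<Rightarrow> 'a::euclidean_space"
  assumes norm1: "\<And>j. j < m \<Longrightarrow> norm (n j) = 1" and i: "i < m"
    and bdd: "bounded (halfspaces n b m)"
    and r: "\<And>x. x \<in> cell n b m i \<Longrightarrow> b i - n i \<bullet> x \<le> r"
    and u: "u \<in> Cc_inf (halfspaces n b m)" and pq: "1 \<le> q" "q < p" and c: "0 < c"
    and A: "A = (pi_pq p q / 2) powr p / r powr p * (p/q * c powr (p/q - 1))"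
    and B: "B = (pi_pq p q / 2) powr p / r powr p * ((p/q - 1) * c powr (p/q))"
  shows "A * (LINT x:cell n b m i|lborel. \<bar>u x\<bar> powr q)
    \<le> (LINT x:cell n b m i|lborel. norm (grad u x) powr p) + B * measure lborel (cell n b m i)"
proof -
  define E where "E = cell n b m i"
  define H where "H = halfspaces n b m"
  define g where "g x = frechet_derivative u (at x) (n i)" for x
  define f where "f x = indicator E x * (\<bar>g x\<bar> powr p - A * \<bar>u x\<bar> powr q + B)" for x
  note u' = Cc_infD[OF u]
  have ni: "n i \<bullet> n i = 1" using norm1[OF i] by (simp add: norm_eq_1)
  have p: "p > 0" using pq by simp
  have EH: "E \<subseteq> H" by (auto simp: E_def H_def cell_def)
  have [measurable]: "E \<in> sets borel" by (simp add: E_def cell_borel)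
  have "emeasure lborel E \<le> emeasure lborel H"
    using EH by (intro emeasure_mono) (auto simp: H_def open_halfspaces)
  then have Efin: "emeasure lborel E < \<infinity>"
    using emeasure_bounded_finite[OF bdd] by (simp add: H_def order.strict_trans1)
  have contg: "continuous_on UNIV g"
    unfolding g_def by (intro smooth_continuous_on smooth_frechet_derivative u'(1))
  have intg: "integrable lborel (\<lambda>x. \<bar>g x\<bar> powr p)"
    using p u'
    by (intro compact_support_integrable[of "closure {x. u x \<noteq> 0}"] abs_powr_continuous_on contg)
      (auto simp: g_def frechet_derivative_outside_support)
  have intu: "integrable lborel (\<lambda>x. \<bar>u x\<bar> powr q)"
    using Cc_inf_abs_powr_integrable[OF u] pq by simp
  have intgr: "integrable lborel (\<lambda>x. norm (grad u x) powr p)"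
    using Cc_inf_grad_powr_integrable[OF u p] .
  have int1: "integrable lborel (\<lambda>x. indicator E x * h x)" if "integrable lborel h" for h :: "'a \<Rightarrow> real"
    using integrable_mult_indicator[OF _ that, of E] by simp
  have intE: "integrable lborel (indicator E :: 'a \<Rightarrow> real)"
    using Efin by (intro integrable_real_indicator) auto
  have f_eq: "f x = indicator E x * \<bar>g x\<bar> powr p - A * (indicator E x * \<bar>u x\<bar> powr q) + B * indicator E x" for x
    by (simp add: f_def algebra_simps)
  have intf: "integrable lborel f"
    unfolding f_eq[abs_def] by (intro Bochner_Integration.integrable_add Bochner_Integration.integrable_diff
        integrable_mult_right int1 intg intu intE)
  have [measurable]: "f \<in> borel_measurable borel" using intf by simp
  have line: "(LINT s|lborel. f (x + s *\<^sub>R n i)) \<ge> 0" for x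
  proof -
    \<comment> \<open>The foot of the line on the hyperplane of facet \<open>i\<close>. The line is
      then traversed inwards, so that the parameter \<open>t\<close> is the distance to this
      hyperplane.\<close>
    define y where "y = x + (b i - n i \<bullet> x) *\<^sub>R n i"
    have ny: "n i \<bullet> y = b i" by (simp add: y_def inner_add_right ni)
    have "(LINT s|lborel. f (x + s *\<^sub>R n i)) =
        (LINT t|lborel. f (x + ((b i - n i \<bullet> x) + (-1) * t) *\<^sub>R n i))"
      by (subst lborel_integral_real_affine[of "-1" _ "b i - n i \<bullet> x"]) simp_all
    also have "\<dots> = (LINT t|lborel. f (y + t *\<^sub>R (- n i)))"
      by (simp add: y_def algebra_simps)
    also have "\<dots> \<ge> 0"
    proof -
      define v where "v t = u (y + t *\<^sub>R (- n i))" for t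
      define T where "T = {t. y + t *\<^sub>R (- n i) \<in> E}"
      have sv: "smooth v" unfolding v_def by (rule smooth_along_line[OF u'(1)])
      have level: "b i - n i \<bullet> (y + t *\<^sub>R (- n i)) = t" for t
        by (simp add: inner_add_right inner_diff_right ny ni)
      have T: "0 < t" "t \<le> r" if "t \<in> T" for t
      proof -
        have "y + t *\<^sub>R (- n i) \<in> cell n b m i" using that by (simp add: T_def E_def)
        then have "n i \<bullet> (y + t *\<^sub>R (- n i)) < b i" "b i - n i \<bullet> (y + t *\<^sub>R (- n i)) \<le> r"
          using i r by (auto simp: cell_def halfspaces_def)
        with level[of t] show "0 < t" "t \<le> r" by linarith+
      qed
      have Tdown: "t' \<in> T" if "t \<in> T" "0 < t'" "t' \<le> t" for t t'
      proof -
        have "y + t *\<^sub>R (- n i) \<in> cell n b m i" using that by (simp add: T_def E_def)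
        from cell_line[OF norm1 i this, of "t - t'"] that level[of t]
        have "y + t *\<^sub>R (- n i) + (t - t') *\<^sub>R n i \<in> cell n b m i" by simp
        then show ?thesis by (simp add: T_def E_def algebra_simps)
      qed
      have fT: "f (y + t *\<^sub>R (- n i)) = indicator T t * (\<bar>deriv v t\<bar> powr p - A * \<bar>v t\<bar> powr q + B)" for t
      proof -
        have "deriv v t = frechet_derivative u (at (y + t *\<^sub>R (- n i))) (- n i)"
          using has_derivative_along_line[OF u'(1), of y "- n i" t, THEN frechet_derivative_at, THEN fun_cong, of 1]
          unfolding deriv_eq_frechet_derivative[OF sv] v_def by simp
        also have "\<dots> = - g (y + t *\<^sub>R (- n i))"
          by (simp add: g_def frechet_derivative_eq_inner_grad[OF u'(1)])
        finally show ?thesis by (simp add: f_def T_def v_def indicator_def)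
      qed
      show ?thesis
      proof (cases "T = {}")
        case True
        then show ?thesis unfolding fT by simp
      next
        case False
        define l where "l = Sup T"
        have bddT: "bdd_above T" using T(2) by (rule bdd_aboveI)
        obtain t0 where "t0 \<in> T" using False by auto
        then have l0: "0 < l" using T(1) cSup_upper[OF _ bddT] by (force simp: l_def)
        have lr: "l \<le> r" unfolding l_def using False T(2) by (intro cSup_least) auto
        \<comment> \<open>\<open>T\<close> is an interval with left end 0 that may or may not
          contain its right end \<open>l\<close>; this single point is negligible for the integrals
          below.\<close>
        have Tsub: "t \<in> T \<longleftrightarrow> t \<in> {0<..<l}" if "t \<noteq> l" for t
        proof
          assume "t \<in> T"
          then have "t \<le> l" unfolding l_def using bddT by (rule cSup_upper)
          with that T(1)[OF \<open>t \<in> T\<close>] show "t \<in> {0<..<l}" by auto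
        next
          assume t: "t \<in> {0<..<l}"
          then obtain t1 where "t1 \<in> T" "t < t1"
            using less_cSup_iff[OF False bddT] by (auto simp: l_def)
          with t Tdown[of t1 t] show "t \<in> T" by auto
        qed
        obtain \<eta> where \<eta>: "0 < \<eta>" "\<And>t. t \<le> \<eta> \<Longrightarrow> v t = 0"
        proof -
          \<comment> \<open>\<open>y\<close> lies on a bounding hyperplane, hence outside the closed
            support of \<open>u\<close>, and so does a whole ball around it. For
            \<open>t \<le> 0\<close> the point is on or beyond the hyperplane, where
            \<open>u\<close> vanishes anyway.\<close>
          have yH: "y \<notin> H" using i ny by (force simp: H_def halfspaces_def)
          then have "y \<in> - closure {x. u x \<noteq> 0}" using u'(3) by (auto simp: H_def)
          then obtain \<epsilon> where \<epsilon>: "\<epsilon> > 0" "ball y \<epsilon> \<subseteq> - closure {x. u x \<noteq> 0}"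
            using open_contains_ball[of "- closure {x. u x \<noteq> 0}"] by auto
          show thesis
          proof (rule that[of "\<epsilon> / 2"])
            show "v t = 0" if "t \<le> \<epsilon> / 2" for t
            proof (cases "t \<le> 0")
              case True
              then have "y + t *\<^sub>R (- n i) \<notin> H"
                using level[of t] i by (force simp: H_def halfspaces_def)
              then show ?thesis using Cc_inf_zero_outside[OF u] by (simp add: v_def H_def)
            next
              case False
              then have "y + t *\<^sub>R (- n i) \<in> ball y \<epsilon>"
                using that \<epsilon>(1) norm1[OF i] by (simp add: dist_norm)
              then show ?thesis
                unfolding v_def using \<epsilon>(2) by (intro zero_outside_support[of "y + t *\<^sub>R (- n i)" u]) blast
            qed
          qed (use \<epsilon> in auto)
        qed
        have cont: "continuous_on {0..l} (\<lambda>t. \<bar>v t\<bar> powr q)" "continuous_on {0..l} (\<lambda>t. \<bar>deriv v t\<bar> powr p)"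
          using pq sv by (simp_all add: abs_powr_continuous_on smooth_continuous_on smooth_deriv)
        note si = cont[THEN set_integral_open_interval(1)]
          set_integral_open_interval(1)[OF continuous_on_const[of "{0..l}" B]]
        have "(LINT t|lborel. f (y + t *\<^sub>R (- n i))) =
            (LINT t:{0<..<l}|lborel. \<bar>deriv v t\<bar> powr p - A * \<bar>v t\<bar> powr q + B)"
          unfolding set_lebesgue_integral_def
        proof (rule integral_cong_AE)
          show "(\<lambda>t. f (y + t *\<^sub>R (- n i))) \<in> borel_measurable lborel" by measurable
          have "set_integrable lborel {0<..<l} (\<lambda>t. \<bar>deriv v t\<bar> powr p - A * \<bar>v t\<bar> powr q + B)"
            by (intro set_integral_add set_integral_diff set_integrable_mult_right si)
          then show "(\<lambda>t. indicat_real {0<..<l} t *\<^sub>R (\<bar>deriv v t\<bar> powr p - A * \<bar>v t\<bar> powr q + B)) \<in> borel_measurable lborel"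
            by (auto simp: set_integrable_def)
          have "AE t in lborel. t \<noteq> l" by (rule AE_lborel_singleton)
          then show "AE t in lborel. f (y + t *\<^sub>R (- n i)) =
              indicat_real {0<..<l} t *\<^sub>R (\<bar>deriv v t\<bar> powr p - A * \<bar>v t\<bar> powr q + B)"
            unfolding fT by (rule AE_mp) (auto intro!: AE_I2 simp: Tsub indicator_def)
        qed
        also have "\<dots> = (LINT t:{0<..<l}|lborel. \<bar>deriv v t\<bar> powr p)
            - A * (LINT t:{0<..<l}|lborel. \<bar>v t\<bar> powr q) + B * l"
        proof -
          have "(LINT t:{0<..<l}|lborel. B) = B * l"
            using l0 by (simp add: set_lebesgue_integral_def)
          then show ?thesis
            using si by (simp add: set_integral_add set_integral_diff)
        qed
        also have "\<dots> \<ge> 0"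
          using one_dim_linearised[OF sv \<eta> l0 lr pq c A B] by simp
        finally show ?thesis .
      qed
    qed
    finally show ?thesis .
  qed
  have "0 \<le> (LINT x|lborel. f x)"
    by (rule integral_nonneg_along_lines[OF intf norm1[OF i] line])
  also have "\<dots> = (LINT x|lborel. indicator E x * \<bar>g x\<bar> powr p)
      - A * (LINT x|lborel. indicator E x * \<bar>u x\<bar> powr q) + B * measure lborel E"
    unfolding f_eq using int1[OF intg] int1[OF intu] intE by simp
  also have "(LINT x|lborel. indicator E x * \<bar>g x\<bar> powr p) \<le> (LINT x|lborel. indicator E x * norm (grad u x) powr p)"
  proof (rule integral_mono[OF int1[OF intg] int1[OF intgr]])
    fix x
    have "\<bar>g x\<bar> \<le> norm (grad u x) * norm (n i)"
      unfolding g_def frechet_derivative_eq_inner_grad[OF u'(1)] by (rule Cauchy_Schwarz_ineq2)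
    then have "\<bar>g x\<bar> powr p \<le> norm (grad u x) powr p"
      using norm1[OF i] p by (intro powr_mono2) auto
    then show "indicator E x * \<bar>g x\<bar> powr p \<le> indicator E x * norm (grad u x) powr p"
      by (intro mult_left_mono) auto
  qed
  finally show ?thesis
    by (simp add: E_def set_lebesgue_integral_def)
qed

text \<open>Linearity pays off here: with common coefficients \<open>A\<close> and \<open>B\<close>,
  the inequalities of the disjoint cells simply add up. For the power \<open>p/q\<close> of the
  integrals this would fail.\<close>

lemma halfspaces_inequality:
  fixes n :: "nat \<Rightarrow> 'a::euclidean_space"
  assumes m: "m > 0" and norm1: "\<And>j. j < m \<Longrightarrow> norm (n j) = 1"
    and bdd: "bounded (halfspaces n b m)"
    and r: "\<And>i x. i < m \<Longrightarrow> x \<in> cell n b m i \<Longrightarrow> b i - n i \<bullet> x \<le> r"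
    and u: "u \<in> Cc_inf (halfspaces n b m)" and pq: "1 \<le> q" "q < p" and c: "0 < c"
    and A: "A = (pi_pq p q / 2) powr p / r powr p * (p/q * c powr (p/q - 1))"
    and B: "B = (pi_pq p q / 2) powr p / r powr p * ((p/q - 1) * c powr (p/q))"
  shows "A * (LINT x|lborel. \<bar>u x\<bar> powr q)
    \<le> (LINT x|lborel. norm (grad u x) powr p) + B * measure lborel (halfspaces n b m)"
proof -
  define H where "H = halfspaces n b m"
  have ind: "indicat_real H x = (\<Sum>i<m. indicator (cell n b m i) x)" for x
    using indicator_UN_disjoint[OF _ disjoint_cells, of m n b x, where 'c=real] UN_cell[OF m, of n b]
    by (simp add: H_def)
  have split: "(LINT x|lborel. h x) = (\<Sum>i<m. LINT x:cell n b m i|lborel. h x)"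
    if h: "integrable lborel h" "\<And>x. x \<notin> H \<Longrightarrow> h x = 0" for h :: "'a \<Rightarrow> real"
  proof -
    have "(LINT x|lborel. h x) = (LINT x|lborel. (\<Sum>i<m. indicator (cell n b m i) x *\<^sub>R h x))"
    proof (rule Bochner_Integration.integral_cong)
      fix x
      have "h x = indicator H x * h x" using h(2)[of x] by (cases "x \<in> H") auto
      then show "h x = (\<Sum>i<m. indicator (cell n b m i) x *\<^sub>R h x)"
        by (simp add: ind sum_distrib_right)
    qed simp
    also have "\<dots> = (\<Sum>i<m. LINT x|lborel. indicator (cell n b m i) x *\<^sub>R h x)"
      by (intro Bochner_Integration.integral_sum integrable_mult_indicator h) (simp add: cell_borel)
    finally show ?thesis by (simp add: set_lebesgue_integral_def)
  qed
  have Hfin: "emeasure lborel H < \<infinity>" unfolding H_def by (rule emeasure_bounded_finite[OF bdd])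
  have Hb: "H \<in> sets borel" by (simp add: H_def open_halfspaces)
  have mH: "measure lborel H = (\<Sum>i<m. measure lborel (cell n b m i))"
  proof -
    have "(LINT x|lborel. indicat_real H x) = (\<Sum>i<m. LINT x:cell n b m i|lborel. indicator H x)"
      using Hfin Hb by (intro split integrable_real_indicator) auto
    also have "\<dots> = (\<Sum>i<m. measure lborel (cell n b m i))"
    proof (rule sum.cong[OF refl])
      fix i
      have eq: "indicat_real (cell n b m i) x *\<^sub>R indicat_real H x = indicator (cell n b m i) x" for x
        by (auto simp: indicator_def cell_def H_def)
      show "(LINT x:cell n b m i|lborel. indicat_real H x) = measure lborel (cell n b m i)"
        unfolding set_lebesgue_integral_def eq by simp
    qed
    finally show ?thesis using Hb by simp
  qed
  have "A * (LINT x|lborel. \<bar>u x\<bar> powr q) = (\<Sum>i<m. A * (LINT x:cell n b m i|lborel. \<bar>u x\<bar> powr q))"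
    using Cc_inf_abs_powr_integrable[OF u] pq Cc_inf_zero_outside[OF u]
    by (subst split) (auto simp: H_def sum_distrib_left)
  also have "\<dots> \<le> (\<Sum>i<m. (LINT x:cell n b m i|lborel. norm (grad u x) powr p) + B * measure lborel (cell n b m i))"
    by (intro sum_mono cell_inequality[OF norm1 _ bdd r u pq c A B]) auto
  also have "\<dots> = (LINT x|lborel. norm (grad u x) powr p) + B * measure lborel H"
  proof -
    have "grad u x = 0" if "x \<notin> H" for x
      using that Cc_infD(3)[OF u] by (intro grad_outside_support) (auto simp: H_def)
    then show ?thesis
      using Cc_inf_grad_powr_integrable[OF u] pq
      by (subst split) (auto simp: mH sum.distrib sum_distrib_left)
  qed
  finally show ?thesis by (simp add: H_def)
qed

section \<open>Volume, inradius and the lower bound on the energy\<close>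

lemma measure_open_pos:
  fixes \<Omega> :: "'a::euclidean_space set"
  assumes "open \<Omega>" "bounded \<Omega>" "\<Omega> \<noteq> {}"
  shows "0 < measure lborel \<Omega>"
proof -
  obtain a \<rho> where a: "0 < \<rho>" "ball a \<rho> \<subseteq> \<Omega>"
    using assms open_contains_ball by (metis ex_in_conv)
  have "0 < measure lborel (ball a \<rho>)"
    using content_ball_pos[OF a(1), of a] by (simp add: measure_def)
  also have "\<dots> \<le> measure lborel \<Omega>"
    using a(2) assms emeasure_bounded_finite[OF assms(2)] by (intro measure_mono_fmeasurable) (auto simp: fmeasurable_def)
  finally show ?thesis .
qed

lemma inradius_pos:
  fixes \<Omega> :: "'a::euclidean_space set"
  assumes "open \<Omega>" "bounded \<Omega>" "\<Omega> \<noteq> {}"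
  shows "0 < inradius \<Omega>"
proof -
  obtain a \<rho> where "0 < \<rho>" "ball a \<rho> \<subseteq> \<Omega>"
    using assms open_contains_ball by (metis ex_in_conv)
  then show ?thesis using ball_le_inradius[OF assms(2)] by force
qed

text \<open>With unit \<open>q\<close>-integral the lower bound is \<open>A - B * V\<close>. As a
  function of the point of tangency it is largest at \<open>1 / V\<close>, where it equals
  \<open>M * (1 / V) powr (p/q - 1)\<close>.\<close>

lemma energy_lower_bound:
  fixes \<Omega> :: "'a::euclidean_space set"
  assumes \<Omega>: "open \<Omega>" "bounded \<Omega>" "convex \<Omega>" "\<Omega> \<noteq> {}" and pq: "1 \<le> q" "q < p"
    and \<psi>: "\<psi> \<in> Cc_inf \<Omega>" "(LINT x:\<Omega>|lborel. \<bar>\<psi> x\<bar> powr q) = 1"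
  shows "(pi_pq p q / 2) powr p / inradius \<Omega> powr p
    \<le> (LINT x:\<Omega>|lborel. norm (grad \<psi> x) powr p) * measure lborel \<Omega> powr ((p - q) / q)"
proof -
  define K where "K = closure {x. \<psi> x \<noteq> 0}"
  define r where "r = inradius \<Omega>"
  define V where "V = measure lborel \<Omega>"
  define M where "M = (pi_pq p q / 2) powr p / r powr p"
  define A where "A = M * (p/q * (1 / V) powr (p/q - 1))"
  define B where "B = M * ((p/q - 1) * (1 / V) powr (p/q))"
  have V: "V > 0" using measure_open_pos \<Omega> by (auto simp: V_def)
  have "K \<noteq> {}"
  proof
    assume "K = {}"
    then have "\<psi> x = 0" for x using zero_outside_support[of x \<psi>] by (simp add: K_def)
    with \<psi>(2) show False by (simp add: set_lebesgue_integral_def)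
  qed
  then obtain m n b where m: "m > 0" and norm1: "\<And>j. j < m \<Longrightarrow> norm (n j) = 1"
    and K: "K \<subseteq> halfspaces n b m" and H: "halfspaces n b m \<subseteq> \<Omega>"
    using ex_halfspaces_between[OF \<Omega>(1-3), of K] Cc_infD[OF \<psi>(1)] by (auto simp: K_def)
  have bdd: "bounded (halfspaces n b m)" using H \<Omega>(2) bounded_subset by blast
  \<comment> \<open>In cell \<open>i\<close> the distance to facet \<open>i\<close> is the smallest
    of all, so the ball of that radius lies in the polytope and hence in \<Omega>.\<close>
  have rad: "b i - n i \<bullet> x \<le> r" if "i < m" "x \<in> cell n b m i" for i x
  proof -
    have "ball x (b i - n i \<bullet> x) \<subseteq> halfspaces n b m"
      using that by (intro ball_subset_halfspaces norm1) (auto simp: cell_def)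
    moreover have "b i - n i \<bullet> x > 0" using that by (simp add: cell_def halfspaces_def)
    ultimately show ?thesis unfolding r_def using H by (intro ball_le_inradius \<Omega>) auto
  qed
  have u: "\<psi> \<in> Cc_inf (halfspaces n b m)"
    using Cc_infD[OF \<psi>(1)] K by (auto simp: Cc_inf_def K_def)
  define G where "G = (LINT x|lborel. norm (grad \<psi> x) powr p)"
  have "A * (LINT x|lborel. \<bar>\<psi> x\<bar> powr q) \<le> G + B * measure lborel (halfspaces n b m)"
    unfolding G_def using V
    by (intro halfspaces_inequality[OF m norm1 bdd rad u pq, where c = "1 / V"]) (auto simp: A_def B_def M_def)
  \<comment> \<open>\<open>B\<close> is non-negative, so the volume of the polytope may be replaced
    by that of \<Omega>; no convergence of the polytopes to \<Omega> is involved.\<close>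
  also have "B * measure lborel (halfspaces n b m) \<le> B * V"
  proof (rule mult_left_mono)
    show "measure lborel (halfspaces n b m) \<le> V"
      unfolding V_def using H \<Omega> emeasure_bounded_finite[OF \<Omega>(2)]
      by (intro measure_mono_fmeasurable) (auto simp: fmeasurable_def open_halfspaces)
    show "B \<ge> 0" using pq by (auto simp: B_def M_def)
  qed
  finally have "A - B * V \<le> G"
    using \<psi> Cc_inf_set_integral[OF \<psi>(1), of q] by simp
  moreover have "A - B * V = M * (1 / V) powr (p/q - 1)"
  proof -
    have "(1 / V) powr (p/q) * V = (1 / V) powr (p/q - 1)"
      using V by (simp add: powr_diff)
    then show ?thesis by (simp add: A_def B_def algebra_simps)
  qed
  ultimately have "M * (1 / V) powr (p/q - 1) * V powr (p/q - 1) \<le> G * V powr (p/q - 1)"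
    by (intro mult_right_mono) auto
  also have "M * (1 / V) powr (p/q - 1) * V powr (p/q - 1) = M"
    using V by (simp add: powr_divide)
  finally have "M \<le> G * V powr ((p - q) / q)"
    using pq by (simp add: diff_divide_distrib)
  then show ?thesis
    by (simp add: M_def r_def V_def G_def Cc_inf_set_integral_grad[OF \<psi>(1)])
qed

subsection \<open>Bounds for the principal frequency\<close>

lemma lambda_pq_bdd_below:
  "bdd_below {(LINT x:\<Omega>|lborel. norm (grad \<psi> x) powr p) | \<psi>.
        \<psi> \<in> Cc_inf \<Omega> \<and> (LINT x:\<Omega>|lborel. \<bar>\<psi> x\<bar> powr q) = 1}"
  by (rule bdd_belowI[of _ 0]) (auto intro!: set_integral_nonneg_pointwise)

lemma grad_cmult:
  assumes "smooth \<psi>"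
  shows "grad (\<lambda>x. c * \<psi> x) x = c *\<^sub>R grad \<psi> x"
proof -
  have "((\<lambda>x. c * \<psi> x) has_derivative (\<lambda>v. c * frechet_derivative \<psi> (at x) v)) (at x)"
    by (intro has_derivative_mult_right smooth_has_derivative assms)
  then have "frechet_derivative (\<lambda>x. c * \<psi> x) (at x) = (\<lambda>v. c * frechet_derivative \<psi> (at x) v)"
    by (rule frechet_derivative_at[symmetric])
  then show ?thesis by (simp add: grad_def scaleR_sum_right)
qed

lemma lambda_pq_normalise:
  fixes \<Omega> :: "'a::euclidean_space set"
  assumes \<psi>: "\<psi> \<in> Cc_inf \<Omega>" and pos: "(LINT x|lborel. \<bar>\<psi> x\<bar> powr q) > 0" and pq: "0 < p" "0 < q"
  shows "(LINT x|lborel. norm (grad \<psi> x) powr p) / (LINT x|lborel. \<bar>\<psi> x\<bar> powr q) powr (p/q)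
     \<in> {(LINT x:\<Omega>|lborel. norm (grad \<psi> x) powr p) | \<psi>.
        \<psi> \<in> Cc_inf \<Omega> \<and> (LINT x:\<Omega>|lborel. \<bar>\<psi> x\<bar> powr q) = 1}"
proof -
  define X where "X = (LINT x|lborel. \<bar>\<psi> x\<bar> powr q)"
  define c where "c = X powr (- 1 / q)"
  have "0 < X" using pos by (simp add: X_def)
  note c = normalising_factor[OF this pq(2) c_def]
  have c\<psi>: "(\<lambda>x. c * \<psi> x) \<in> Cc_inf \<Omega>"
    using c by (intro Cc_inf_cmult \<psi>) simp
  have "(LINT x:\<Omega>|lborel. \<bar>c * \<psi> x\<bar> powr q) = c powr q * X"
    unfolding Cc_inf_set_integral[OF c\<psi>] using c(1) by (simp add: X_def abs_mult powr_mult)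
  then have 1: "(LINT x:\<Omega>|lborel. \<bar>c * \<psi> x\<bar> powr q) = 1"
    using c(2) by simp
  have "(LINT x:\<Omega>|lborel. norm (grad (\<lambda>x. c * \<psi> x) x) powr p)
      = c powr p * (LINT x|lborel. norm (grad \<psi> x) powr p)"
    unfolding Cc_inf_set_integral_grad[OF c\<psi>] using c(1)
    by (simp add: grad_cmult[OF Cc_infD(1)[OF \<psi>]] powr_mult)
  also have "\<dots> = (LINT x|lborel. norm (grad \<psi> x) powr p) / X powr (p/q)"
    by (simp add: c(3))
  finally show ?thesis
    using c\<psi> 1 unfolding X_def[symmetric] by (intro CollectI exI[of _ "\<lambda>x. c * \<psi> x"]) simp
qed

lemma lambda_pq_le:
  assumes "\<psi> \<in> Cc_inf \<Omega>" "(LINT x|lborel. \<bar>\<psi> x\<bar> powr q) > 0" "0 < p" "0 < q"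
  shows "lambda_pq p q \<Omega> \<le> (LINT x|lborel. norm (grad \<psi> x) powr p) / (LINT x|lborel. \<bar>\<psi> x\<bar> powr q) powr (p/q)"
  unfolding lambda_pq_def
  by (rule cInf_lower[OF lambda_pq_normalise[OF assms] lambda_pq_bdd_below])

lemma lambda_pq_lower_bound:
  fixes \<Omega> :: "'a::euclidean_space set"
  assumes \<Omega>: "open \<Omega>" "bounded \<Omega>" "convex \<Omega>" "\<Omega> \<noteq> {}" and pq: "1 \<le> q" "q < p"
  shows "(pi_pq p q / 2) powr p / inradius \<Omega> powr p
    \<le> lambda_pq p q \<Omega> * measure lborel \<Omega> powr ((p - q) / q)"
proof -
  define W where "W = measure lborel \<Omega> powr ((p - q) / q)"
  have W: "W > 0" using measure_open_pos \<Omega> by (force simp: W_def)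
  obtain \<psi> where \<psi>: "\<psi> \<in> Cc_inf \<Omega>" "(LINT x:\<Omega>|lborel. \<bar>\<psi> x\<bar> powr q) > 0"
    using ex_test_function[OF \<Omega>(1,4), of q] pq by auto
  have "(pi_pq p q / 2) powr p / inradius \<Omega> powr p / W \<le> lambda_pq p q \<Omega>"
    unfolding lambda_pq_def
  proof (rule cInf_greatest)
    show "{(LINT x:\<Omega>|lborel. norm (grad \<psi> x) powr p) | \<psi>.
        \<psi> \<in> Cc_inf \<Omega> \<and> (LINT x:\<Omega>|lborel. \<bar>\<psi> x\<bar> powr q) = 1} \<noteq> {}"
      using lambda_pq_normalise[OF \<psi>(1), of q p] \<psi>(2) pq Cc_inf_set_integral[OF \<psi>(1), of q] by auto
  next
    fix y assume "y \<in> {(LINT x:\<Omega>|lborel. norm (grad \<psi> x) powr p) | \<psi>.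
        \<psi> \<in> Cc_inf \<Omega> \<and> (LINT x:\<Omega>|lborel. \<bar>\<psi> x\<bar> powr q) = 1}"
    then obtain \<phi> where \<phi>: "\<phi> \<in> Cc_inf \<Omega>" "(LINT x:\<Omega>|lborel. \<bar>\<phi> x\<bar> powr q) = 1"
      and y: "y = (LINT x:\<Omega>|lborel. norm (grad \<phi> x) powr p)" by blast
    show "(pi_pq p q / 2) powr p / inradius \<Omega> powr p / W \<le> y"
      using energy_lower_bound[OF \<Omega> pq \<phi>] W by (simp only: y W_def pos_divide_le_eq)
  qed
  then show ?thesis using W by (simp only: W_def pos_divide_le_eq)
qed

section \<open>Smooth steps and cutoffs\<close>

lemma ex_smooth_step:
  "\<exists>S :: real \<Rightarrow> real. smooth S \<and> (\<forall>t. 0 \<le> S t \<and> S t \<le> 1) \<and> (\<forall>t\<le>0. S t = 0) \<and> (\<forall>t\<ge>1. S t = 1)"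
proof -
  obtain h :: "real \<Rightarrow> real" where h: "smooth h" "\<And>x. x > 0 \<Longrightarrow> h x > 0" "\<And>x. x \<le> 0 \<Longrightarrow> h x = 0"
    using ex_smooth_positive by blast
  have h0: "h x \<ge> 0" for x using h(2,3)[of x] by (cases "x > 0") auto
  have pos: "h t + h (1 - t) > 0" for t
    using h(2)[of t] h(2)[of "1 - t"] h0[of t] h0[of "1 - t"] by (cases "t > 0") auto
  have "smooth (\<lambda>t. h t / (h t + h (1 - t)))"
    by (intro smooth_divide smooth_add h(1) smooth_compose[OF h(1), of "\<lambda>t. 1 - t"]
        smooth_diff smooth_const smooth_ident pos)
  moreover have "h t / (h t + h (1 - t)) = 1" if "t \<ge> 1" for t
    using h(2)[of t] h(3)[of "1 - t"] that by simp
  ultimately show ?thesis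
    using h0 pos h(3) by (intro exI[of _ "\<lambda>t. h t / (h t + h (1 - t))"])
      (auto simp: divide_le_eq divide_nonneg_pos less_imp_le)
qed

lemma ex_cutoff:
  assumes \<delta>: "0 < \<delta>"
  shows "\<exists>\<eta> :: 'a::euclidean_space \<Rightarrow> real. smooth \<eta> \<and> (\<forall>x. 0 \<le> \<eta> x \<and> \<eta> x \<le> 1)
    \<and> (\<forall>x. (\<forall>b\<in>Basis. \<bar>x \<bullet> b\<bar> \<le> 1) \<longrightarrow> \<eta> x = 1) \<and> (\<forall>x. \<forall>b\<in>Basis. \<bar>x \<bullet> b\<bar> > 1 + \<delta> \<longrightarrow> \<eta> x = 0)"
proof -
  obtain S :: "real \<Rightarrow> real" where S: "smooth S" "\<And>t. 0 \<le> S t" "\<And>t. S t \<le> 1"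
    "\<And>t. t \<le> 0 \<Longrightarrow> S t = 0" "\<And>t. t \<ge> 1 \<Longrightarrow> S t = 1"
    using ex_smooth_step by blast
  \<comment> \<open>Squared coordinates keep the argument of \<open>S\<close> smooth. Dividing by
    \<open>k\<close> makes it at least 1 when the coordinate has modulus at most 1, and at most 0
    from \<open>1 + \<delta>\<close> on.\<close>
  define k where "k = (1 + \<delta>)\<^sup>2 - 1"
  have k: "k > 0" using power_strict_mono[of 1 "1 + \<delta>" 2] \<delta> by (simp add: k_def)
  define T where "T x b = S (((1 + \<delta>)\<^sup>2 - (x \<bullet> b) * (x \<bullet> b)) * (1 / k))" for x b :: 'a
  define \<eta> where "\<eta> x = (\<Prod>b\<in>Basis. T x b)" for x
  have "smooth \<eta>"
    unfolding \<eta>_def T_def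
    by (intro smooth_prod smooth_compose[OF S(1)] smooth_mult[OF smooth_diff] smooth_mult smooth_const
        smooth_inner) auto
  moreover have "0 \<le> \<eta> x \<and> \<eta> x \<le> 1" for x
    unfolding \<eta>_def T_def using S by (auto intro!: prod_nonneg prod_le_1)
  moreover have "\<eta> x = 1" if "\<forall>b\<in>Basis. \<bar>x \<bullet> b\<bar> \<le> 1" for x
  proof -
    have "T x b = 1" if "b \<in> Basis" for b
    proof -
      have "(x \<bullet> b)\<^sup>2 \<le> 1\<^sup>2" using that \<open>\<forall>b\<in>Basis. \<bar>x \<bullet> b\<bar> \<le> 1\<close> by (simp add: abs_square_le_1)
      then show ?thesis unfolding T_def using k by (intro S(5)) (simp add: k_def power2_eq_square field_simps)
    qed
    then show ?thesis by (simp add: \<eta>_def)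
  qed
  moreover have "\<eta> x = 0" if b: "b \<in> Basis" and "\<bar>x \<bullet> b\<bar> > 1 + \<delta>" for x b
  proof -
    have "(1 + \<delta>)\<^sup>2 \<le> \<bar>x \<bullet> b\<bar>\<^sup>2" using that \<delta> by (intro power_mono) auto
    then have "T x b = 0"
      unfolding T_def using k by (intro S(4) mult_nonpos_nonneg) (auto simp: power2_eq_square)
    then show ?thesis using b by (auto simp: \<eta>_def)
  qed
  ultimately show ?thesis by blast
qed

section \<open>Thin slabs\<close>

definition slab :: "'a::euclidean_space \<Rightarrow> real \<Rightarrow> real \<Rightarrow> 'a set" where
  "slab e \<epsilon> w = {x. 0 < x \<bullet> e \<and> x \<bullet> e < \<epsilon> \<and> (\<forall>b\<in>Basis - {e}. \<bar>x \<bullet> b\<bar> < w)}"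

lemma slab_eq_box:
  assumes "e \<in> Basis"
  shows "slab e \<epsilon> w = box (\<Sum>b\<in>Basis. (if b = e then 0 else - w) *\<^sub>R b) (\<Sum>b\<in>Basis. (if b = e then \<epsilon> else w) *\<^sub>R b)"
proof (intro equalityI subsetI)
  fix x assume "x \<in> slab e \<epsilon> w"
  then show "x \<in> box (\<Sum>b\<in>Basis. (if b = e then 0 else - w) *\<^sub>R b) (\<Sum>b\<in>Basis. (if b = e then \<epsilon> else w) *\<^sub>R b)"
    unfolding mem_box
  proof (intro ballI)
    fix b :: 'a assume "b \<in> Basis"
    with \<open>x \<in> slab e \<epsilon> w\<close> have "(if b = e then 0 else - w) < x \<bullet> b \<and> x \<bullet> b < (if b = e then \<epsilon> else w)"
      by (auto simp: slab_def abs_less_iff dest!: bspec[of _ _ b])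
    with \<open>b \<in> Basis\<close>
    show "(\<Sum>b\<in>Basis. (if b = e then 0 else - w) *\<^sub>R b) \<bullet> b < x \<bullet> b
        \<and> x \<bullet> b < (\<Sum>b\<in>Basis. (if b = e then \<epsilon> else w) *\<^sub>R b) \<bullet> b"
      by simp
  qed
next
  fix x assume x: "x \<in> box (\<Sum>b\<in>Basis. (if b = e then 0 else - w) *\<^sub>R b) (\<Sum>b\<in>Basis. (if b = e then \<epsilon> else w) *\<^sub>R b)"
  then have *: "(if b = e then 0 else - w) < x \<bullet> b \<and> x \<bullet> b < (if b = e then \<epsilon> else w)" if "b \<in> Basis" for b
    using that by (simp add: mem_box)
  have "\<bar>x \<bullet> b\<bar> < w" if "b \<in> Basis - {e}" for b
    using *[of b] that by auto
  with *[OF assms] show "x \<in> slab e \<epsilon> w"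
    by (simp add: slab_def)
qed

lemma open_slab: "e \<in> Basis \<Longrightarrow> open (slab e \<epsilon> w)"
  and bounded_slab: "e \<in> Basis \<Longrightarrow> bounded (slab e \<epsilon> w)"
  and convex_slab: "e \<in> Basis \<Longrightarrow> convex (slab e \<epsilon> w)"
  by (simp_all add: slab_eq_box open_box bounded_box convex_box)

lemma measure_slab:
  assumes e: "(e::'a::euclidean_space) \<in> Basis" and "0 < \<epsilon>" "0 < w"
  shows "measure lborel (slab e \<epsilon> w) = \<epsilon> * (2 * w) ^ (DIM('a) - 1)"
proof -
  have "measure lborel (slab e \<epsilon> w) = (\<Prod>b\<in>Basis. (if b = e then \<epsilon> else 2 * w))"
    unfolding slab_eq_box[OF e] using assms
    by (subst measure_lborel_box) (auto intro!: prod.cong simp: inner_diff_left)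
  also have "\<dots> = \<epsilon> * (\<Prod>b\<in>Basis - {e}. (if b = e then \<epsilon> else 2 * w))"
    using e by (subst prod.remove[of _ e]) auto
  also have "(\<Prod>b\<in>Basis - {e}. (if b = e then \<epsilon> else 2 * w)) = (\<Prod>b\<in>Basis - {e}. 2 * w)"
    by (intro prod.cong) auto
  also have "\<dots> = (2 * w) ^ (DIM('a) - 1)" using e by simp
  finally show ?thesis .
qed

lemma slab_integrable:
  assumes e: "(e::'a::euclidean_space) \<in> Basis" and g: "continuous_on UNIV (g :: 'a \<Rightarrow> real)"
  shows "integrable lborel (\<lambda>x. indicator (slab e \<epsilon> w) x * g x)"
proof -
  let ?a = "\<Sum>b\<in>Basis. (if b = e then 0 else - w) *\<^sub>R b"
  let ?b = "\<Sum>b\<in>Basis. (if b = e then \<epsilon> else w) *\<^sub>R b"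
  have "set_integrable lborel (cbox ?a ?b) g"
    unfolding set_integrable_def
    by (intro borel_integrable_compact compact_cbox continuous_on_subset[OF g]) simp
  then have "set_integrable lborel (slab e \<epsilon> w) g"
    by (rule set_integrable_subset) (auto simp: slab_eq_box[OF e] intro: box_subset_cbox[THEN subsetD])
  then show ?thesis by (simp add: set_integrable_def)
qed

text \<open>Instead of a coordinate-wise Fubini argument, the mean \<open>I\<close> is subtracted;
  the claim then says that an integral vanishes, and this can be tested on lines of direction
  \<open>e\<close>.\<close>

lemma slab_integral:
  assumes e: "(e::'a::euclidean_space) \<in> Basis" and \<epsilon>: "0 < \<epsilon>" and w: "0 < w" and g: "continuous_on UNIV g"
  shows "(LINT x|lborel. indicator (slab e \<epsilon> w) x * g (x \<bullet> e / \<epsilon>))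
    = measure lborel (slab e \<epsilon> w) * (LINT t:{0<..<1}|lborel. g t)"
proof -
  define I where "I = (LINT t:{0<..<1}|lborel. g t)"
  define f where "f x = indicator (slab e \<epsilon> w) x * (g (x \<bullet> e / \<epsilon>) - I)" for x
  have cont: "continuous_on UNIV (\<lambda>x. g (x \<bullet> e / \<epsilon>))"
    by (rule continuous_on_compose2[OF g]) (use \<epsilon> in \<open>auto intro!: continuous_intros\<close>)
  have intg: "integrable lborel (\<lambda>x. indicator (slab e \<epsilon> w) x * g (x \<bullet> e / \<epsilon>))"
    by (rule slab_integrable[OF e cont])
  have intI: "integrable lborel (\<lambda>x. indicator (slab e \<epsilon> w) x * I)"
    by (rule slab_integrable[OF e]) simp
  have f_eq: "f x = indicator (slab e \<epsilon> w) x * g (x \<bullet> e / \<epsilon>) - indicator (slab e \<epsilon> w) x * I" for x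
    by (simp add: f_def algebra_simps)
  have "(LINT x|lborel. f x) = 0"
  proof (rule integral_eq_0_along_lines)
    show "integrable lborel f"
      unfolding f_eq[abs_def] by (rule Bochner_Integration.integrable_diff[OF intg intI])
    show "norm e = 1" using e by simp
    fix x :: 'a
    define Q where "Q \<longleftrightarrow> (\<forall>b\<in>Basis - {e}. \<bar>x \<bullet> b\<bar> < w)"
    have ee: "e \<bullet> e = 1" using e by simp
    have coord: "(x + s *\<^sub>R e) \<bullet> b = x \<bullet> b" if "b \<in> Basis - {e}" for b s
      using that e by (auto simp: inner_add_left inner_Basis)
    \<comment> \<open>The line is parametrised so that the slab corresponds to the unit interval;
      \<open>Q\<close> records whether the line meets the slab at all.\<close>
    have line: "f (x + (- (x \<bullet> e) + \<epsilon> * t) *\<^sub>R e) = of_bool Q * (indicator {0<..<1} t * (g t - I))" for t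
    proof -
      have "(x + (- (x \<bullet> e) + \<epsilon> * t) *\<^sub>R e) \<bullet> e = \<epsilon> * t"
        by (simp add: inner_add_left ee)
      then show ?thesis
        using \<epsilon> coord by (auto simp: f_def slab_def Q_def indicator_def mult_less_cancel_left1 zero_less_mult_iff)
    qed
    have gi: "set_integrable lborel {0<..<1} g"
      by (rule set_integral_open_interval(1)) (rule continuous_on_subset[OF g], simp)
    have "(LINT t|lborel. indicator {0<..<1} t * (g t - I)) = (LINT t:{0<..<1}|lborel. g t - I)"
      by (simp add: set_lebesgue_integral_def)
    also have "\<dots> = I - (LINT t:{0<..<1::real}|lborel. I)"
      unfolding I_def by (rule set_integral_diff(2)[OF gi set_integral_open_interval(1)]) simp
    also have "(LINT t:{0<..<1::real}|lborel. I) = I" by (simp add: set_lebesgue_integral_def)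
    finally have 0: "(LINT t|lborel. indicator {0<..<1} t * (g t - I)) = 0" by simp
    have "(LINT s|lborel. f (x + s *\<^sub>R e)) = \<bar>\<epsilon>\<bar> *\<^sub>R (LINT t|lborel. f (x + (- (x \<bullet> e) + \<epsilon> * t) *\<^sub>R e))"
      using \<epsilon> by (intro lborel_integral_real_affine) simp
    then show "(LINT s|lborel. f (x + s *\<^sub>R e)) = 0"
      unfolding line using 0 by simp
  qed
  then show ?thesis
    using intg intI emeasure_bounded_finite[OF bounded_slab[OF e]]
    by (simp add: f_eq[abs_def] I_def)
qed

lemma inradius_slab_le:
  assumes e: "(e::'a::euclidean_space) \<in> Basis" and "0 < \<epsilon>" "0 < w"
  shows "inradius (slab e \<epsilon> w) \<le> \<epsilon> / 2"
  unfolding inradius_def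
proof (rule cSup_least)
  have "slab e \<epsilon> w \<noteq> {}"
    using measure_slab[OF assms] assms by force
  then obtain y where "y \<in> slab e \<epsilon> w" by auto
  moreover from this obtain r where "r > 0" "ball y r \<subseteq> slab e \<epsilon> w"
    using open_contains_ball open_slab[OF e] by blast
  ultimately show "{r. r > 0 \<and> (\<exists>x0\<in>slab e \<epsilon> w. ball x0 r \<subseteq> slab e \<epsilon> w)} \<noteq> {}" by auto
next
  fix r assume "r \<in> {r. r > 0 \<and> (\<exists>x0\<in>slab e \<epsilon> w. ball x0 r \<subseteq> slab e \<epsilon> w)}"
  then obtain y where r: "r > 0" "ball y r \<subseteq> slab e \<epsilon> w" by auto
  have bound: "2 * s \<le> \<epsilon>" if "0 \<le> s" "s < r" for s
  proof -
    have "y + s *\<^sub>R e \<in> slab e \<epsilon> w" "y - s *\<^sub>R e \<in> slab e \<epsilon> w"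
      using r that e by (auto simp: dist_norm intro!: subsetD[OF r(2)])
    then have "y \<bullet> e + s < \<epsilon>" "0 < y \<bullet> e - s"
      using e by (auto simp: slab_def inner_add_left inner_diff_left)
    then show ?thesis by linarith
  qed
  show "r \<le> \<epsilon> / 2"
  proof (rule dense_le_bounded[OF r(1)])
    fix s assume "0 < s" "s < r"
    then show "s \<le> \<epsilon> / 2" using bound[of s] by simp
  qed
qed

lemma compact_support_bounded:
  fixes f :: "'a::euclidean_space \<Rightarrow> 'b::real_normed_vector"
  assumes "compact K" "continuous_on UNIV f" "\<And>x. x \<notin> K \<Longrightarrow> f x = 0"
  shows "\<exists>C\<ge>0. \<forall>x. norm (f x) \<le> C"
proof -
  have "bounded (f ` K)"
    by (intro compact_imp_bounded compact_continuous_image continuous_on_subset[OF assms(2)] assms(1)) simp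
  then obtain C where C: "\<forall>y\<in>f ` K. norm y \<le> C" by (auto simp: bounded_iff)
  have "norm (f x) \<le> max C 0" for x
    using C assms(3)[of x] by (cases "x \<in> K") (auto simp: le_max_iff_disj)
  then show ?thesis by (intro exI[of _ "max C 0"]) auto
qed

text \<open>The gradient of the test function is at most
  \<open>(\<bar>u'\<bar> + \<epsilon> * C) / \<epsilon>\<close>, where the cutoff contributes only
  \<open>\<epsilon> * C\<close> and \<open>C\<close> does not depend on \<epsilon>. The support of
  the cutoff stays within \<open>1 + \<delta>\<close>, compactly inside the half-width
  \<open>1 + 2 * \<delta>\<close>. The prefactor is the price of counting the
  \<open>q\<close>-integral only where the cutoff is 1.\<close>

lemma slab_quotient_le:
  fixes e :: "'a::euclidean_space"
  assumes e: "e \<in> Basis" and pq: "1 \<le> q" "q < p" and \<delta>: "0 < \<delta>"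
    and u: "u \<in> Cc_inf {0<..<1}" and norm1: "(LINT t:{0<..<1}|lborel. \<bar>u t\<bar> powr q) = 1"
  shows "\<exists>C\<ge>0. \<forall>\<epsilon>. 0 < \<epsilon> \<longrightarrow> \<epsilon> \<le> 1 \<longrightarrow>
    lambda_pq p q (slab e \<epsilon> (1 + 2 * \<delta>)) * measure lborel (slab e \<epsilon> (1 + 2 * \<delta>)) powr ((p - q) / q)
        * inradius (slab e \<epsilon> (1 + 2 * \<delta>)) powr p
    \<le> ((1 + 2 * \<delta>) ^ (DIM('a) - 1)) powr (p/q) * (LINT t:{0<..<1}|lborel. (\<bar>deriv u t\<bar> + \<epsilon> * C) powr p) / 2 powr p"
proof -
  obtain \<eta> :: "'a \<Rightarrow> real" where \<eta>: "smooth \<eta>" "\<And>x. 0 \<le> \<eta> x" "\<And>x. \<eta> x \<le> 1"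
    and \<eta>1: "\<And>x. (\<forall>b\<in>Basis. \<bar>x \<bullet> b\<bar> \<le> 1) \<Longrightarrow> \<eta> x = 1"
    and \<eta>0: "\<And>x b. b \<in> Basis \<Longrightarrow> \<bar>x \<bullet> b\<bar> > 1 + \<delta> \<Longrightarrow> \<eta> x = 0"
    using ex_cutoff[OF \<delta>] by metis
  note u' = Cc_infD[OF u]
  define Ku where "Ku = closure {t. u t \<noteq> 0}"
  define Q where "Q = cbox (- (1 + \<delta>) *\<^sub>R One) ((1 + \<delta>) *\<^sub>R One :: 'a)"
  have Q: "x \<in> Q \<longleftrightarrow> (\<forall>b\<in>Basis. \<bar>x \<bullet> b\<bar> \<le> 1 + \<delta>)" for x
    unfolding Q_def mem_box by (auto simp: abs_le_iff minus_le_iff)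
  have \<eta>Q: "\<eta> x = 0" if "x \<notin> Q" for x
    using that \<eta>0 unfolding Q by force
  have "closure {x. \<eta> x \<noteq> 0} \<subseteq> Q"
    using \<eta>Q by (intro closure_minimal) (auto simp: Q_def)
  then have "grad \<eta> x = 0" if "x \<notin> Q" for x
    using that by (intro grad_outside_support) auto
  then obtain C1 where C1: "C1 \<ge> 0" "\<And>x. norm (grad \<eta> x) \<le> C1"
    using compact_support_bounded[of Q "grad \<eta>"] smooth_grad_continuous[OF \<eta>(1)] by (auto simp: Q_def)
  obtain C2 where C2: "C2 \<ge> 0" "\<And>t. \<bar>u t\<bar> \<le> C2"
    using compact_support_bounded[OF u'(2) smooth_continuous_on[OF u'(1)] zero_outside_support[where \<psi> = u]] by auto
  define C where "C = C2 * C1"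
  have C: "C \<ge> 0" using C1 C2 by (simp add: C_def)
  define w where "w = 1 + 2 * \<delta>"
  have w: "w > 0" using \<delta> by (simp add: w_def)
  have p: "p > 0" and q: "q > 0" using pq by auto
  have main: "lambda_pq p q (slab e \<epsilon> w) * measure lborel (slab e \<epsilon> w) powr ((p - q) / q)
      * inradius (slab e \<epsilon> w) powr p
    \<le> (w ^ (DIM('a) - 1)) powr (p/q) * (LINT t:{0<..<1}|lborel. (\<bar>deriv u t\<bar> + \<epsilon> * C) powr p) / 2 powr p"
    if \<epsilon>: "0 < \<epsilon>" "\<epsilon> \<le> 1" for \<epsilon>
  proof -
    define \<psi> where "\<psi> x = u (x \<bullet> e * (1 / \<epsilon>)) * \<eta> x" for x
    define V where "V = measure lborel (slab e \<epsilon> w)"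
    define J where "J = (LINT t:{0<..<1}|lborel. (\<bar>deriv u t\<bar> + \<epsilon> * C) powr p)"
    define W where "W = w ^ (DIM('a) - 1)"
    have W: "W > 0" using w by (simp add: W_def)
    have V_eq: "V = \<epsilon> * (2 * w) ^ (DIM('a) - 1)"
      unfolding V_def by (rule measure_slab[OF e \<epsilon>(1) w])
    then have V: "V > 0" using \<epsilon> w by simp
    have s\<psi>: "smooth \<psi>"
      unfolding \<psi>_def by (intro smooth_mult[OF smooth_compose[OF u'(1)]] smooth_mult smooth_inner smooth_const \<eta>)
    have \<psi>: "\<psi> \<in> Cc_inf (slab e \<epsilon> w)"
    proof (rule Cc_infI[OF s\<psi>])
      let ?L = "(\<lambda>x::'a. x \<bullet> e * (1 / \<epsilon>)) -` Ku"
      have "closed ?L"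
        by (intro closed_vimage continuous_intros) (simp add: Ku_def)
      then show "compact (?L \<inter> Q)"
        by (intro closed_Int_compact) (simp_all add: Q_def)
      show "?L \<inter> Q \<subseteq> slab e \<epsilon> w"
      proof
        fix x assume x: "x \<in> ?L \<inter> Q"
        then have "x \<bullet> e * (1 / \<epsilon>) \<in> {0<..<1}" using u'(3) by (auto simp: Ku_def)
        then have "0 < x \<bullet> e" "x \<bullet> e < \<epsilon>" using \<epsilon> by (auto simp: field_simps zero_less_mult_iff)
        moreover have "\<bar>x \<bullet> b\<bar> < w" if "b \<in> Basis" for b
          using x that \<delta> by (force simp: Q w_def)
        ultimately show "x \<in> slab e \<epsilon> w" by (simp add: slab_def)
      qed
      show "\<psi> x = 0" if "x \<notin> ?L \<inter> Q" for x
        using that \<eta>Q[of x] zero_outside_support[of "x \<bullet> e * (1 / \<epsilon>)" u] by (auto simp: \<psi>_def Ku_def)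
    qed
    have grad_le: "norm (grad \<psi> x) \<le> (\<bar>deriv u (x \<bullet> e / \<epsilon>)\<bar> + \<epsilon> * C) / \<epsilon>" for x
    proof -
      define a where "a = deriv u (x \<bullet> e * (1 / \<epsilon>))"
      \<comment> \<open>The derivative is applied to the gradient \<open>z\<close> itself; this
        bounds \<open>z \<bullet> z\<close> by a multiple of \<open>norm z\<close>, which is then
        cancelled.\<close>
      define z where "z = grad \<psi> x"
      have "((\<lambda>x. u (x \<bullet> e * (1 / \<epsilon>))) has_derivative (\<lambda>v. a * (v \<bullet> e * (1 / \<epsilon>)))) (at x)"
        by (rule has_derivative_compose[of "\<lambda>x. x \<bullet> e * (1 / \<epsilon>)" _ _ _ u "(*) a"])
          (use \<epsilon> smooth_has_real_derivative[OF u'(1)] in \<open>auto intro!: derivative_eq_intros simp: a_def has_field_derivative_def\<close>)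
      from has_derivative_mult[OF this smooth_has_derivative[OF \<eta>(1), of x]]
      have "frechet_derivative \<psi> (at x) = (\<lambda>v. u (x \<bullet> e * (1 / \<epsilon>)) * frechet_derivative \<eta> (at x) v
          + a * (v \<bullet> e * (1 / \<epsilon>)) * \<eta> x)"
        unfolding \<psi>_def[abs_def] by (rule frechet_derivative_at[symmetric])
      then have "z \<bullet> z = u (x \<bullet> e * (1 / \<epsilon>)) * (grad \<eta> x \<bullet> z) + a * (z \<bullet> e * (1 / \<epsilon>)) * \<eta> x"
        using frechet_derivative_eq_inner_grad[OF s\<psi>, of x z] frechet_derivative_eq_inner_grad[OF \<eta>(1), of x z]
        by (simp add: z_def)
      also have "\<dots> \<le> C2 * (C1 * norm z) + \<bar>a\<bar> * (norm z * (1 / \<epsilon>)) * 1"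
      proof (rule add_mono)
        have "\<bar>u (x \<bullet> e * (1 / \<epsilon>)) * (grad \<eta> x \<bullet> z)\<bar> \<le> C2 * (C1 * norm z)"
          unfolding abs_mult
          by (intro mult_mono C2 order_trans[OF Cauchy_Schwarz_ineq2] mult_right_mono C1) auto
        then show "u (x \<bullet> e * (1 / \<epsilon>)) * (grad \<eta> x \<bullet> z) \<le> C2 * (C1 * norm z)" by linarith
        have "\<bar>z \<bullet> e\<bar> \<le> norm z" using Basis_le_norm[OF e] .
        then have "\<bar>a * (z \<bullet> e * (1 / \<epsilon>)) * \<eta> x\<bar> \<le> \<bar>a\<bar> * (norm z * (1 / \<epsilon>)) * 1"
          unfolding abs_mult using \<epsilon> \<eta>(2,3)[of x]
          by (intro mult_mono) (auto simp: divide_right_mono)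
        then show "a * (z \<bullet> e * (1 / \<epsilon>)) * \<eta> x \<le> \<bar>a\<bar> * (norm z * (1 / \<epsilon>)) * 1" by linarith
      qed
      finally have "norm z * norm z \<le> norm z * ((\<bar>a\<bar> + \<epsilon> * C) / \<epsilon>)"
        using \<epsilon> by (simp add: C_def power2_norm_eq_inner[symmetric] power2_eq_square field_simps)
      moreover have "0 \<le> (\<bar>a\<bar> + \<epsilon> * C) / \<epsilon>"
        using \<epsilon> C by simp
      ultimately have "norm z \<le> (\<bar>a\<bar> + \<epsilon> * C) / \<epsilon>"
        by (metis mult_left_le_imp_le norm_zero zero_less_norm_iff)
      then show ?thesis by (simp add: z_def a_def)
    qed
    have contJ: "continuous_on UNIV (\<lambda>t. (\<bar>deriv u t\<bar> + \<epsilon> * C) powr p)"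
      using p C \<epsilon> by (intro continuous_on_powr' continuous_intros smooth_continuous_on smooth_deriv u') auto
    have intJ: "integrable lborel (\<lambda>x. indicator (slab e \<epsilon> w) x * (\<bar>deriv u (x \<bullet> e / \<epsilon>)\<bar> + \<epsilon> * C) powr p)"
      by (rule slab_integrable[OF e], rule continuous_on_compose2[OF contJ])
        (use \<epsilon> in \<open>auto intro!: continuous_intros\<close>)
    have "(LINT x|lborel. norm (grad \<psi> x) powr p)
        \<le> (LINT x|lborel. (1 / \<epsilon> powr p) * (indicator (slab e \<epsilon> w) x * (\<bar>deriv u (x \<bullet> e / \<epsilon>)\<bar> + \<epsilon> * C) powr p))"
    proof (rule integral_mono[OF Cc_inf_grad_powr_integrable[OF \<psi> p] integrable_mult_right[OF intJ]])
      fix x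
      show "norm (grad \<psi> x) powr p
        \<le> (1 / \<epsilon> powr p) * (indicator (slab e \<epsilon> w) x * (\<bar>deriv u (x \<bullet> e / \<epsilon>)\<bar> + \<epsilon> * C) powr p)"
      proof (cases "x \<in> slab e \<epsilon> w")
        case True
        have "norm (grad \<psi> x) powr p \<le> ((\<bar>deriv u (x \<bullet> e / \<epsilon>)\<bar> + \<epsilon> * C) / \<epsilon>) powr p"
          using grad_le p by (intro powr_mono2) auto
        with True \<epsilon> C show ?thesis by (simp add: powr_divide)
      next
        case False
        then have "grad \<psi> x = 0"
          using Cc_infD(3)[OF \<psi>] by (intro grad_outside_support) auto
        with False show ?thesis by simp
      qed
    qed
    also have "\<dots> = (1 / \<epsilon> powr p) * (V * J)"
      using slab_integral[OF e \<epsilon>(1) w contJ] by (simp add: V_def J_def)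
    finally have P: "(LINT x|lborel. norm (grad \<psi> x) powr p) \<le> V * J / \<epsilon> powr p" by simp
    have contu: "continuous_on UNIV (\<lambda>t. \<bar>u t\<bar> powr q)"
      by (intro abs_powr_continuous_on smooth_continuous_on u' q)
    have "V / W = measure lborel (slab e \<epsilon> 1)"
      \<comment> \<open>\<open>W\<close> is the ratio of the volumes of the full slab and the inner
        slab of half-width 1.\<close>
      using measure_slab[OF e \<epsilon>(1), of 1] w by (simp add: V_eq W_def power_mult_distrib)
    also have "\<dots> = (LINT x|lborel. indicator (slab e \<epsilon> 1) x * \<bar>u (x \<bullet> e / \<epsilon>)\<bar> powr q)"
      using slab_integral[OF e \<epsilon>(1) _ contu, of 1] norm1 by simp
    also have "\<dots> \<le> (LINT x|lborel. \<bar>\<psi> x\<bar> powr q)"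
    proof (rule integral_mono[OF _ Cc_inf_abs_powr_integrable[OF \<psi> q]])
      show "integrable lborel (\<lambda>x. indicator (slab e \<epsilon> 1) x * \<bar>u (x \<bullet> e / \<epsilon>)\<bar> powr q)"
        by (rule slab_integrable[OF e], rule continuous_on_compose2[OF contu])
          (use \<epsilon> in \<open>auto intro!: continuous_intros\<close>)
      fix x
      show "indicator (slab e \<epsilon> 1) x * \<bar>u (x \<bullet> e / \<epsilon>)\<bar> powr q \<le> \<bar>\<psi> x\<bar> powr q"
      proof (cases "x \<in> slab e \<epsilon> 1")
        case True
        \<comment> \<open>In direction \<open>e\<close> this uses \<open>\<epsilon> \<le> 1\<close>:
          the cutoff acts in all coordinates, and the thin direction has to stay on its
          plateau.\<close>
        then have "\<bar>x \<bullet> b\<bar> \<le> 1" if "b \<in> Basis" for b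
          using that \<epsilon> by (cases "b = e") (auto simp: slab_def intro: less_imp_le)
        then have "\<eta> x = 1" using \<eta>1 by blast
        with True show ?thesis by (simp add: \<psi>_def)
      qed simp
    qed
    finally have Q': "V / W \<le> (LINT x|lborel. \<bar>\<psi> x\<bar> powr q)" .
    have VW: "0 < V / W" using V W by simp
    have J: "J \<ge> 0" unfolding J_def by (rule set_integral_nonneg_pointwise) simp
    have "lambda_pq p q (slab e \<epsilon> w)
        \<le> (LINT x|lborel. norm (grad \<psi> x) powr p) / (LINT x|lborel. \<bar>\<psi> x\<bar> powr q) powr (p/q)"
      using VW Q' by (intro lambda_pq_le \<psi> p q) linarith
    also have "\<dots> \<le> (V * J / \<epsilon> powr p) / (V / W) powr (p/q)"
      using VW Q' P p q V J by (intro frac_le powr_mono2) auto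
    finally have "lambda_pq p q (slab e \<epsilon> w) * V powr ((p - q) / q)
        \<le> (V * J / \<epsilon> powr p) / (V / W) powr (p/q) * V powr ((p - q) / q)"
      by (rule mult_right_mono) simp
    \<comment> \<open>The powers of \<open>V\<close> cancel, since
      \<open>1 - p/q + (p - q)/q = 0\<close>; the remaining \<open>\<epsilon> powr p\<close> is
      cancelled by the inradius bound \<open>\<epsilon> / 2\<close>.\<close>
    also have "\<dots> = W powr (p/q) * J / \<epsilon> powr p"
      using V W q by (simp add: powr_divide diff_divide_distrib powr_diff)
    finally have "lambda_pq p q (slab e \<epsilon> w) * V powr ((p - q) / q) * inradius (slab e \<epsilon> w) powr p
        \<le> W powr (p/q) * J / \<epsilon> powr p * (\<epsilon> / 2) powr p"
    proof (rule mult_mono)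
      have "slab e \<epsilon> w \<noteq> {}" using V by (auto simp: V_def)
      then have "0 < inradius (slab e \<epsilon> w)"
        by (intro inradius_pos open_slab bounded_slab e)
      then show "inradius (slab e \<epsilon> w) powr p \<le> (\<epsilon> / 2) powr p"
        using inradius_slab_le[OF e \<epsilon>(1) w] p by (intro powr_mono2) auto
    qed (use J in auto)
    also have "\<dots> = W powr (p/q) * J / 2 powr p"
      using \<epsilon> by (simp add: powr_divide)
    finally show ?thesis by (simp add: V_def W_def J_def)
  qed
  show ?thesis
    using C main by (intro exI[of _ C]) (simp add: w_def)
qed

text \<open>Dominated convergence, the integrand with perturbation \<open>C\<close> itself being the
  majorant because \<open>inverse (real (Suc n)) \<le> 1\<close>.\<close>

lemma perturbed_energy_tendsto:
  assumes u: "smooth u" and C: "0 \<le> C" and p: "0 < p"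
  shows "(\<lambda>n. LINT t:{0<..<1}|lborel. (\<bar>deriv u t\<bar> + inverse (real (Suc n)) * C) powr p)
    \<longlonglongrightarrow> (LINT t:{0<..<1::real}|lborel. \<bar>deriv u t\<bar> powr p)"
proof -
  define J where "J s t = indicator {0<..<1} t *\<^sub>R (\<bar>deriv u t\<bar> + s * C) powr p" for s t :: real
  have int: "integrable lborel (J s)" if "s \<ge> 0" for s
  proof -
    have "continuous_on {0..1} (\<lambda>t. (\<bar>deriv u t\<bar> + s * C) powr p)"
      using p C that by (intro continuous_on_powr' continuous_intros smooth_continuous_on smooth_deriv u) auto
    from set_integral_open_interval(1)[OF this] show ?thesis
      by (simp add: set_integrable_def J_def[abs_def])
  qed
  have "(\<lambda>n. LINT t|lborel. J (inverse (real (Suc n))) t) \<longlonglongrightarrow> (LINT t|lborel. J 0 t)"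
  proof (rule integral_dominated_convergence[where w = "J 1"])
    show "AE t in lborel. (\<lambda>n. J (inverse (real (Suc n))) t) \<longlonglongrightarrow> J 0 t"
    proof (rule AE_I2)
      fix t :: real
      have "(\<lambda>n. \<bar>deriv u t\<bar> + inverse (real (Suc n)) * C) \<longlonglongrightarrow> \<bar>deriv u t\<bar> + 0 * C"
        by (intro tendsto_intros LIMSEQ_inverse_real_of_nat)
      then show "(\<lambda>n. J (inverse (real (Suc n))) t) \<longlonglongrightarrow> J 0 t"
        unfolding J_def using C p by (intro tendsto_scaleR tendsto_const tendsto_powr') auto
    qed
    show "AE t in lborel. norm (J (inverse (real (Suc n))) t) \<le> J 1 t" for n
    proof (rule AE_I2)
      fix t :: real
      have "inverse (real (Suc n)) * C \<le> 1 * C"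
        using C by (intro mult_right_mono) (auto simp: field_simps)
      then show "norm (J (inverse (real (Suc n))) t) \<le> J 1 t"
        unfolding J_def using p C by (auto simp: indicator_def intro!: powr_mono2)
    qed
  qed (use int[of 0] int[of 1] int in \<open>auto\<close>)
  then show ?thesis by (simp add: J_def set_lebesgue_integral_def)
qed

theorem theorem5p7:
  fixes p q :: real
  assumes "1 \<le> q" "q < p"
  shows "(\<forall>\<Omega>::'a::euclidean_space set. open \<Omega> \<and> bounded \<Omega> \<and> convex \<Omega> \<and> \<Omega> \<noteq> {} \<longrightarrow>
           lambda_pq p q \<Omega> * measure lborel \<Omega> powr ((p - q) / q)
             \<ge> (pi_pq p q / 2) powr p / inradius \<Omega> powr p)
         \<and> Inf {lambda_pq p q \<Omega> * measure lborel \<Omega> powr ((p - q) / q) * inradius \<Omega> powr p | \<Omega>::'a set.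
              open \<Omega> \<and> bounded \<Omega> \<and> convex \<Omega> \<and> \<Omega> \<noteq> {}} = (pi_pq p q / 2) powr p"
    (is "?bound \<and> Inf ?S = _")
proof
  have p: "0 < p" and q: "0 < q" using assms by auto
  show ?bound
    using lambda_pq_lower_bound[OF _ _ _ _ assms] by blast
  obtain e :: 'a where e: "e \<in> Basis" using nonempty_Basis by blast
  have slabs: "slab e \<epsilon> w \<noteq> {}" if "0 < \<epsilon>" "0 < w" for \<epsilon> w
    using measure_slab[OF e that] that by force
  have mem: "lambda_pq p q (slab e \<epsilon> w) * measure lborel (slab e \<epsilon> w) powr ((p - q) / q)
      * inradius (slab e \<epsilon> w) powr p \<in> ?S" if "0 < \<epsilon>" "0 < w" for \<epsilon> w
    using slabs[OF that] e by (intro CollectI exI[of _ "slab e \<epsilon> w"]) (simp add: open_slab bounded_slab convex_slab)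
  have lower: "(pi_pq p q / 2) powr p \<le> y" if "y \<in> ?S" for y
    using that
  proof (elim CollectE exE conjE)
    fix \<Omega> :: "'a set"
    assume \<Omega>: "open \<Omega>" "bounded \<Omega>" "convex \<Omega>" "\<Omega> \<noteq> {}"
      and y: "y = lambda_pq p q \<Omega> * measure lborel \<Omega> powr ((p - q) / q) * inradius \<Omega> powr p"
    have "inradius \<Omega> powr p > 0" using inradius_pos[OF \<Omega>(1,2,4)] by simp
    then show ?thesis
      using lambda_pq_lower_bound[OF \<Omega> assms] by (simp only: y pos_divide_le_eq)
  qed
  have bdd: "bdd_below ?S" using lower by (rule bdd_belowI)
  have ge: "(pi_pq p q / 2) powr p \<le> Inf ?S"
    using mem[of 1 1] lower by (intro cInf_greatest) auto
  then have I0: "Inf ?S \<ge> 0" by (rule order_trans[rotated]) simp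
  have upper: "Inf ?S \<le> (LINT t:{0<..<1}|lborel. \<bar>deriv u t\<bar> powr p) / 2 powr p"
    if u: "u \<in> Cc_inf {0<..<1}" and norm1: "(LINT t:{0<..<1}|lborel. \<bar>u t\<bar> powr q) = 1" for u
  proof -
    define Y where "Y = (LINT t:{0<..<1}|lborel. \<bar>deriv u t\<bar> powr p)"
    \<comment> \<open>The thickness tends to 0 with \<delta> fixed, because \<open>C\<close> depends
      on \<delta>; after this limit \<open>C\<close> has disappeared and \<delta> is free to tend to
      0.\<close>
    have step: "Inf ?S \<le> ((1 + 2 * \<delta>) ^ (DIM('a) - 1)) powr (p/q) * Y / 2 powr p" if \<delta>: "0 < \<delta>" for \<delta>
    proof -
      obtain C where C: "C \<ge> 0" and quot: "\<And>\<epsilon>. 0 < \<epsilon> \<Longrightarrow> \<epsilon> \<le> 1 \<Longrightarrow>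
          lambda_pq p q (slab e \<epsilon> (1 + 2 * \<delta>)) * measure lborel (slab e \<epsilon> (1 + 2 * \<delta>)) powr ((p - q) / q)
            * inradius (slab e \<epsilon> (1 + 2 * \<delta>)) powr p
          \<le> ((1 + 2 * \<delta>) ^ (DIM('a) - 1)) powr (p/q) * (LINT t:{0<..<1}|lborel. (\<bar>deriv u t\<bar> + \<epsilon> * C) powr p) / 2 powr p"
        using slab_quotient_le[OF e assms \<delta> u norm1] by blast
      have "(\<lambda>n. ((1 + 2 * \<delta>) ^ (DIM('a) - 1)) powr (p/q)
          * (LINT t:{0<..<1}|lborel. (\<bar>deriv u t\<bar> + inverse (real (Suc n)) * C) powr p) / 2 powr p)
        \<longlonglongrightarrow> ((1 + 2 * \<delta>) ^ (DIM('a) - 1)) powr (p/q) * Y / 2 powr p"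
        unfolding Y_def
        by (intro tendsto_divide tendsto_mult tendsto_const perturbed_energy_tendsto Cc_infD(1)[OF u] C p) simp
      then show ?thesis
      proof (rule LIMSEQ_le_const, intro exI allI impI)
        fix n :: nat
        have n: "0 < inverse (real (Suc n))" "inverse (real (Suc n)) \<le> 1" by (auto simp: field_simps)
        show "Inf ?S \<le> ((1 + 2 * \<delta>) ^ (DIM('a) - 1)) powr (p/q)
          * (LINT t:{0<..<1}|lborel. (\<bar>deriv u t\<bar> + inverse (real (Suc n)) * C) powr p) / 2 powr p"
          using cInf_lower[OF mem[OF n(1), of "1 + 2 * \<delta>"] bdd] quot[OF n] \<delta> by linarith
      qed
    qed
    have "(\<lambda>n. ((1 + 2 * inverse (real (Suc n))) ^ (DIM('a) - 1)) powr (p/q) * Y / 2 powr p)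
        \<longlonglongrightarrow> ((1 + 2 * 0) ^ (DIM('a) - 1)) powr (p/q) * Y / 2 powr p"
      by (intro tendsto_divide tendsto_mult tendsto_powr tendsto_power tendsto_add tendsto_const
          LIMSEQ_inverse_real_of_nat) auto
    then have "Inf ?S \<le> ((1 + 2 * 0) ^ (DIM('a) - 1)) powr (p/q) * Y / 2 powr p"
      by (rule LIMSEQ_le_const) (use step in auto)
    then show ?thesis by (simp add: Y_def)
  qed
  \<comment> \<open>\<open>pi_pq\<close> is an infimum of \<open>p\<close>-th roots, so the bound is
    compared with each root, and the \<open>p\<close>-th power is taken only after the
    infimum.\<close>
  have "(Inf ?S * 2 powr p) powr (1/p) \<le> pi_pq p q"
    unfolding pi_pq_def
  proof (rule cInf_greatest)
    obtain u where "u \<in> Cc_inf {0<..<1::real}" "(LINT t:{0<..<1}|lborel. \<bar>u t\<bar> powr q) > 0"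
      using ex_test_function[of "{0<..<1::real}" q] q by auto
    from pi_pq_normalise[OF this(1) q this(2)]
    show "{(LINT x:{0<..<1}|lborel. \<bar>deriv u x\<bar> powr p) powr (1/p) | u.
        u \<in> Cc_inf {0<..<(1::real)} \<and> (LINT x:{0<..<1}|lborel. \<bar>u x\<bar> powr q) powr (1/q) = 1} \<noteq> {}"
      by (rule ex_in_conv[THEN iffD1, OF exI])
  next
    fix y assume "y \<in> {(LINT x:{0<..<1}|lborel. \<bar>deriv u x\<bar> powr p) powr (1/p) | u.
        u \<in> Cc_inf {0<..<(1::real)} \<and> (LINT x:{0<..<1}|lborel. \<bar>u x\<bar> powr q) powr (1/q) = 1}"
    then obtain u where u: "u \<in> Cc_inf {0<..<1}" "(LINT x:{0<..<1}|lborel. \<bar>u x\<bar> powr q) powr (1/q) = 1"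
      and y: "y = (LINT x:{0<..<1}|lborel. \<bar>deriv u x\<bar> powr p) powr (1/p)" by blast
    have "(LINT x:{0<..<1}|lborel. \<bar>u x\<bar> powr q) = ((LINT x:{0<..<1}|lborel. \<bar>u x\<bar> powr q) powr (1/q)) powr q"
      using q set_integral_nonneg_pointwise[of "\<lambda>x. \<bar>u x\<bar> powr q" lborel "{0<..<1}"] by (simp add: powr_powr)
    then have "(LINT x:{0<..<1}|lborel. \<bar>u x\<bar> powr q) = 1" using u(2) by simp
    from upper[OF u(1) this] have "Inf ?S * 2 powr p \<le> (LINT t:{0<..<1}|lborel. \<bar>deriv u t\<bar> powr p)"
      by (simp add: pos_le_divide_eq)
    then show "(Inf ?S * 2 powr p) powr (1/p) \<le> y"
      unfolding y using p I0 by (intro powr_mono2) auto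
  qed
  then have "((Inf ?S * 2 powr p) powr (1/p)) powr p \<le> pi_pq p q powr p"
    using p by (intro powr_mono2) auto
  then have "Inf ?S * 2 powr p \<le> pi_pq p q powr p"
    using p I0 by (simp add: powr_powr)
  then have "Inf ?S \<le> (pi_pq p q / 2) powr p"
    using pi_pq_nonneg[OF q] by (simp add: powr_divide pos_le_divide_eq)
  with ge show "Inf ?S = (pi_pq p q / 2) powr p" by simp
qed

end
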